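(* Let $k_1,k_2\ge 1$ be constants. There is a randomized algorithm which, given any $\varepsilon>0$ and any two mixtures of product distributions $\mathbb P=\sum_{s=1}^{k_1}\alpha^{(s)}\bigotimes_{i=1}^n\mathbb P^{(s)}_i$ and $\mathbb Q=\sum_{t=1}^{k_2}\beta^{(t)}\bigotimes_{i=1}^n\mathbb Q^{(t)}_i$ over $[q]^n$, runs in time $O\!\left(\frac{q^2(nq)^{2(k_1+k_2-1)}}{\varepsilon^2}\right)$ and outputs a number $\hat d$ such that, with probability at least $99\%$, $$(1-\varepsilon)\,d_{TV}(\mathbb P,\mathbb Q)\le \hat d\le (1+\varepsilon)\,d_{TV}(\mathbb P,\mathbb Q).$$
   Context: $[q]=\{1,\dots,q\}$. A mixture of product distributions over $[q]^n$ with $k$ components is a distribution $\mathbb P=\sum_{s=1}^{k}\alpha^{(s)}\bigotimes_{i=1}^n\mathbb P^{(s)}_i$, i.e. $\mathbb P(\omega)=\sum_{s=1}^k\alpha^{(s)}\prod_{i=1}^n\mathbb P^{(s)}_i(\omega_i)$ for $\omega\in[q]^n$, where $\alpha^{(s)}\ge 0$, $\sum_s\alpha^{(s)}=1$, and each $\mathbb P^{(s)}_i$ is a distribution on $[q]$. The input consists of the mixing weights and all marginals $\mathbb P^{(s)}_i$ (input size $O((k_1+k_2)nq)$). The total variation distance is $d_{TV}(\mathbb P,\mathbb Q)=\frac12\sum_{\omega}|\mathbb P(\omega)-\mathbb Q(\omega)|$. *)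

theory Defs
  imports "HOL-Probability.Probability"
begin

section \<open>Mixtures of product distributions\<close>

definition distribution_on :: "'a set \<Rightarrow> ('a \<Rightarrow> real) \<Rightarrow> bool" where
  "distribution_on A f \<longleftrightarrow> (\<forall>a\<in>A. 0 \<le> f a) \<and> (\<Sum>a\<in>A. f a) = 1"

text \<open>\<open>\<mu> s i a\<close> is the probability that the \<open>i\<close>-th marginal of component \<open>s\<close> gives to \<open>a\<close>.
  Components, coordinates and symbols are numbered from 1.\<close>

definition mixture_data ::
    "nat \<Rightarrow> nat \<Rightarrow> nat \<Rightarrow> (nat \<Rightarrow> real) \<Rightarrow> (nat \<Rightarrow> nat \<Rightarrow> nat \<Rightarrow> real) \<Rightarrow> bool" where
  "mixture_data k n q w \<mu> \<longleftrightarrow>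
     distribution_on {1..k} w \<and> (\<forall>s\<in>{1..k}. \<forall>i\<in>{1..n}. distribution_on {1..q} (\<mu> s i))"

definition mixture ::
    "nat \<Rightarrow> nat \<Rightarrow> (nat \<Rightarrow> real) \<Rightarrow> (nat \<Rightarrow> nat \<Rightarrow> nat \<Rightarrow> real) \<Rightarrow> (nat \<Rightarrow> nat) \<Rightarrow> real" where
  "mixture k n w \<mu> \<omega> = (\<Sum>s=1..k. w s * (\<Prod>i=1..n. \<mu> s i (\<omega> i)))"

definition cube :: "nat \<Rightarrow> nat \<Rightarrow> (nat \<Rightarrow> nat) set" where
  "cube n q = {1..n} \<rightarrow>\<^sub>E {1..q}"

definition tv_dist :: "'a set \<Rightarrow> ('a \<Rightarrow> real) \<Rightarrow> ('a \<Rightarrow> real) \<Rightarrow> real" where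
  "tv_dist \<Omega> f g = (1/2) * (\<Sum>\<omega>\<in>\<Omega>. \<bar>f \<omega> - g \<omega>\<bar>)"


section \<open>Randomized real-RAM programs\<close>

text \<open>
  The memory consists of named arrays of natural numbers (for indices and counters) and named
  arrays of reals; a scalar variable is cell 0 of an array. Programs compute with reals by
  exact field operations and comparisons only: there is no rounding of a real to a natural number,
  and the only constants in a program text are natural numbers. The one source of randomness is
  a coin whose bias is a computed real. A program is a fixed finite text, so each transition of the
  semantics below evaluates expressions of bounded size and costs \<open>O(1)\<close> operations; running time is
  the number of transitions.
\<close>

record state =
  imem :: "string \<Rightarrow> nat \<Rightarrow> nat"
  rmem :: "string \<Rightarrow> nat \<Rightarrow> real"

datatype iexp =
    INum nat
  | IGet string iexp
  | IAdd iexp iexp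
  | ISub iexp iexp
  | IMul iexp iexp

datatype rexp =
    ROfNat iexp
  | RGet string iexp
  | RAdd rexp rexp
  | RSub rexp rexp
  | RMul rexp rexp
  | RDiv rexp rexp

datatype bexp =
    ILess iexp iexp
  | RLess rexp rexp
  | BNot bexp
  | BAnd bexp bexp

datatype com =
    Skip
  | IPut string iexp iexp
  | RPut string iexp rexp
  | Flip string iexp rexp
  | Seq com com
  | Cond bexp com com
  | While bexp com

primrec ival :: "iexp \<Rightarrow> state \<Rightarrow> nat" where
  "ival (INum m) \<sigma> = m"
| "ival (IGet x e) \<sigma> = imem \<sigma> x (ival e \<sigma>)"
| "ival (IAdd e f) \<sigma> = ival e \<sigma> + ival f \<sigma>"
| "ival (ISub e f) \<sigma> = ival e \<sigma> - ival f \<sigma>"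
| "ival (IMul e f) \<sigma> = ival e \<sigma> * ival f \<sigma>"

primrec rval :: "rexp \<Rightarrow> state \<Rightarrow> real" where
  "rval (ROfNat e) \<sigma> = real (ival e \<sigma>)"
| "rval (RGet x e) \<sigma> = rmem \<sigma> x (ival e \<sigma>)"
| "rval (RAdd e f) \<sigma> = rval e \<sigma> + rval f \<sigma>"
| "rval (RSub e f) \<sigma> = rval e \<sigma> - rval f \<sigma>"
| "rval (RMul e f) \<sigma> = rval e \<sigma> * rval f \<sigma>"
| "rval (RDiv e f) \<sigma> = rval e \<sigma> / rval f \<sigma>"

primrec bval :: "bexp \<Rightarrow> state \<Rightarrow> bool" where
  "bval (ILess e f) \<sigma> \<longleftrightarrow> ival e \<sigma> < ival f \<sigma>"
| "bval (RLess e f) \<sigma> \<longleftrightarrow> rval e \<sigma> < rval f \<sigma>"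
| "bval (BNot b) \<sigma> \<longleftrightarrow> \<not> bval b \<sigma>"
| "bval (BAnd b c) \<sigma> \<longleftrightarrow> bval b \<sigma> \<and> bval c \<sigma>"

definition iput :: "string \<Rightarrow> nat \<Rightarrow> nat \<Rightarrow> state \<Rightarrow> state" where
  "iput x j v \<sigma> = \<sigma>\<lparr>imem := (imem \<sigma>)(x := (imem \<sigma> x)(j := v))\<rparr>"

definition rput :: "string \<Rightarrow> nat \<Rightarrow> real \<Rightarrow> state \<Rightarrow> state" where
  "rput x j v \<sigma> = \<sigma>\<lparr>rmem := (rmem \<sigma>)(x := (rmem \<sigma> x)(j := v))\<rparr>"

text \<open>\<open>Flip x e p\<close> stores 1 with probability \<open>p\<close> and 0 otherwise; \<^const>\<open>bernoulli_pmf\<close> truncates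
  \<open>p\<close> to \<open>[0,1]\<close>. The program \<open>Skip\<close> is the halted program and steps to itself.\<close>

primrec step :: "com \<Rightarrow> state \<Rightarrow> (com \<times> state) pmf" where
  "step Skip \<sigma> = return_pmf (Skip, \<sigma>)"
| "step (IPut x e f) \<sigma> = return_pmf (Skip, iput x (ival e \<sigma>) (ival f \<sigma>) \<sigma>)"
| "step (RPut x e f) \<sigma> = return_pmf (Skip, rput x (ival e \<sigma>) (rval f \<sigma>) \<sigma>)"
| "step (Flip x e p) \<sigma> =
     map_pmf (\<lambda>b. (Skip, iput x (ival e \<sigma>) (if b then 1 else 0) \<sigma>)) (bernoulli_pmf (rval p \<sigma>))"
| "step (Seq c d) \<sigma> =
     (if c = Skip then return_pmf (d, \<sigma>)
      else map_pmf (\<lambda>(c', \<sigma>'). (Seq c' d, \<sigma>')) (step c \<sigma>))"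
| "step (Cond b c d) \<sigma> = return_pmf (if bval b \<sigma> then c else d, \<sigma>)"
| "step (While b c) \<sigma> = return_pmf (if bval b \<sigma> then Seq c (While b c) else Skip, \<sigma>)"

primrec run :: "nat \<Rightarrow> com \<Rightarrow> state \<Rightarrow> (com \<times> state) pmf" where
  "run 0 c \<sigma> = return_pmf (c, \<sigma>)"
| "run (Suc t) c \<sigma> = bind_pmf (step c \<sigma>) (\<lambda>(c', \<sigma>'). run t c' \<sigma>')"

text \<open>Worst case over all outcomes of the coin flips.\<close>

definition halts_within :: "nat \<Rightarrow> com \<Rightarrow> state \<Rightarrow> bool" where
  "halts_within t c \<sigma> \<longleftrightarrow> (\<forall>(c', \<sigma>') \<in> set_pmf (run t c \<sigma>). c' = Skip)"

definition out_dist :: "nat \<Rightarrow> com \<Rightarrow> state \<Rightarrow> real pmf" where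
  "out_dist t c \<sigma> = map_pmf (\<lambda>(c', \<sigma>'). rmem \<sigma>' ''out'' 0) (run t c \<sigma>)"


section \<open>The input\<close>

text \<open>All cells not mentioned below are arbitrary, so programs cannot rely on them.
  The address \<open>(s * n + i) * q + a\<close> determines \<open>s\<close>, \<open>i \<in> {1..n}\<close> and \<open>a \<in> {1..q}\<close>, see below.\<close>

definition stores_mixture ::
    "state \<Rightarrow> string \<Rightarrow> string \<Rightarrow> nat \<Rightarrow> nat \<Rightarrow> nat \<Rightarrow>
     (nat \<Rightarrow> real) \<Rightarrow> (nat \<Rightarrow> nat \<Rightarrow> nat \<Rightarrow> real) \<Rightarrow> bool" where
  "stores_mixture \<sigma> x y k n q w \<mu> \<longleftrightarrow>
     (\<forall>s\<in>{1..k}. rmem \<sigma> x s = w s) \<and>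
     (\<forall>s\<in>{1..k}. \<forall>i\<in>{1..n}. \<forall>a\<in>{1..q}. rmem \<sigma> y ((s * n + i) * q + a) = \<mu> s i a)"

definition input_state ::
    "nat \<Rightarrow> nat \<Rightarrow> nat \<Rightarrow> nat \<Rightarrow> real \<Rightarrow>
     (nat \<Rightarrow> real) \<Rightarrow> (nat \<Rightarrow> nat \<Rightarrow> nat \<Rightarrow> real) \<Rightarrow>
     (nat \<Rightarrow> real) \<Rightarrow> (nat \<Rightarrow> nat \<Rightarrow> nat \<Rightarrow> real) \<Rightarrow> state \<Rightarrow> bool" where
  "input_state k1 k2 n q \<epsilon> \<alpha> P \<beta> Q \<sigma> \<longleftrightarrow>
     imem \<sigma> ''n'' 0 = n \<and> imem \<sigma> ''q'' 0 = q \<and> rmem \<sigma> ''eps'' 0 = \<epsilon> \<and>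
     stores_mixture \<sigma> ''alpha'' ''P'' k1 n q \<alpha> P \<and>
     stores_mixture \<sigma> ''beta'' ''Q'' k2 n q \<beta> Q"

lemma address_inj_aux:
  fixes u v a b q :: nat
  assumes "u * q + a = v * q + b" "a \<in> {1..q}" "b \<in> {1..q}"
  shows "u = v \<and> a = b"
proof -
  obtain a' b' where ab: "a = Suc a'" "b = Suc b'" "a' < q" "b' < q"
    using assms(2,3) by (cases a; cases b) auto
  have "(u * q + a') div q = (v * q + b') div q" using assms(1) ab by simp
  then have "u = v" using ab by simp
  with assms(1) show ?thesis by simp
qed

lemma address_inj:
  fixes s s' i i' a a' n q :: nat
  assumes "(s * n + i) * q + a = (s' * n + i') * q + a'"
    and "i \<in> {1..n}" "i' \<in> {1..n}" "a \<in> {1..q}" "a' \<in> {1..q}"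
  shows "s = s' \<and> i = i' \<and> a = a'"
  using address_inj_aux[OF assms(1,4,5)] address_inj_aux[of s n i s' i'] assms(2,3) by auto

lemma marginals_storable:
  fixes \<mu> :: "nat \<Rightarrow> nat \<Rightarrow> nat \<Rightarrow> real"
  shows "\<exists>m. \<forall>s. \<forall>i\<in>{1..n}. \<forall>a\<in>{1..q}. m ((s * n + i) * q + a) = \<mu> s i a"
proof -
  define good where "good = (\<lambda>x (s, i, a). i \<in> {1..n} \<and> a \<in> {1..q} \<and> x = (s * n + i) * q + a)"
  define m where "m = (\<lambda>x. case SOME z. good x z of (s, i, a) \<Rightarrow> \<mu> s i a)"
  have "m ((s * n + i) * q + a) = \<mu> s i a" if "i \<in> {1..n}" "a \<in> {1..q}" for s i a
  proof -
    have "(SOME z. good ((s * n + i) * q + a) z) = (s, i, a)"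
    proof (rule some_equality)
      show "good ((s * n + i) * q + a) (s, i, a)" using that by (simp add: good_def)
      show "z = (s, i, a)" if "good ((s * n + i) * q + a) z" for z
        using that address_inj[of s n i q a] \<open>i \<in> {1..n}\<close> \<open>a \<in> {1..q}\<close>
        by (cases z) (auto simp: good_def)
    qed
    then show ?thesis by (simp add: m_def)
  qed
  then show ?thesis by blast
qed

lemma input_state_exists: "\<exists>\<sigma>. input_state k1 k2 n q \<epsilon> \<alpha> P \<beta> Q \<sigma>"
proof -
  obtain mP where mP: "\<forall>s. \<forall>i\<in>{1..n}. \<forall>a\<in>{1..q}. mP ((s * n + i) * q + a) = P s i a"
    using marginals_storable by metis
  obtain mQ where mQ: "\<forall>s. \<forall>i\<in>{1..n}. \<forall>a\<in>{1..q}. mQ ((s * n + i) * q + a) = Q s i a"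
    using marginals_storable by metis
  define \<sigma> where "\<sigma> = \<lparr>imem = (\<lambda>x j. if x = ''n'' then n else q),
    rmem = (\<lambda>x. if x = ''eps'' then (\<lambda>j. \<epsilon>) else if x = ''alpha'' then \<alpha>
      else if x = ''beta'' then \<beta> else if x = ''P'' then mP else mQ)\<rparr>"
  have "input_state k1 k2 n q \<epsilon> \<alpha> P \<beta> Q \<sigma>"
    using mP mQ by (simp add: input_state_def stores_mixture_def \<sigma>_def)
  then show ?thesis ..
qed

end

theory Submission
  imports Defs
begin

text \<open>
  Number all \<open>k = k1 + k2\<close> components consecutively, so that \<open>f = P - Q\<close> is a signed combination
  \<open>\<Sum>\<^sub>s c\<^sub>s \<Otimes>\<^sub>i \<mu>\<^sub>s\<^sub>i\<close>, and estimate \<open>\<parallel>f\<parallel>\<^sub>1\<close> by importance sampling from a hidden Markov model \<open>R\<close> whose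
  states are the components: at each coordinate it emits from the current component, except that
  with probability \<open>1 / (2n)\<close> it emits a uniform symbol and moves to a uniform component. The point is
  that \<open>\<bar>f\<bar> \<le> M \<parallel>f\<parallel>\<^sub>1 R\<close> pointwise with \<open>M = O((nq)\<^bsup>k-1\<^esup>)\<close>. Indeed, restricting \<open>f\<close> to \<open>\<omega>\<^sub>i = a\<close>, or summing
  out coordinate \<open>i\<close>, does not increase the norm, and the difference of the first and \<open>\<mu>\<^sub>l\<^sub>i(a)\<close> times the
  second no longer involves component \<open>l\<close>; so \<open>f\<close> telescopes along the coordinates into
  \<open>c \<Otimes>\<^sub>i \<mu>\<^sub>l\<^sub>i\<close> with \<open>\<bar>c\<bar> \<le> \<parallel>f\<parallel>\<^sub>1\<close> and terms with \<open>k - 1\<close> components, which induction bounds.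

  The forward vector of \<open>R\<close> gives both the conditional law of the next symbol and the likelihood, so
  a sample of \<open>\<bar>f\<bar> / R\<close> costs \<open>O(nq)\<close>. Its second moment is at most \<open>O(M)\<close> times its squared mean,
  hence \<open>O(M / \<epsilon>\<^sup>2)\<close> samples suffice by Chebyshev's inequality, and \<open>(nq)\<^bsup>k\<^esup> \<le> (nq)\<^bsup>2(k-1)\<^esup>\<close>.
  For \<open>\<epsilon> \<ge> 1\<close> the answer 0 is good enough.
\<close>

section \<open>Reasoning about programs\<close>

lemma run_Skip [simp]: "run t Skip \<sigma> = return_pmf (Skip, \<sigma>)"
  by (induction t) (simp_all add: bind_return_pmf)

lemma run_add: "run (t + u) c \<sigma> = bind_pmf (run t c \<sigma>) (\<lambda>(c', \<sigma>'). run u c' \<sigma>')"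
proof (induction t arbitrary: c \<sigma>)
  case 0
  then show ?case by (simp add: bind_return_pmf)
next
  case (Suc t)
  then show ?case
    by (simp add: bind_assoc_pmf split_def)
qed

lemma run_halted:
  assumes "halts_within u c \<sigma>"
  shows "run (u + v) c \<sigma> = run u c \<sigma>"
proof -
  have "run (u + v) c \<sigma> = bind_pmf (run u c \<sigma>) return_pmf"
    unfolding run_add using assms
    by (intro bind_pmf_cong) (auto simp: halts_within_def)
  then show ?thesis by (simp add: bind_return_pmf')
qed

text \<open>Branches of \<open>c\<close> may finish at different times, so \<open>d\<close> starts
  early on some of them; it then waits in \<open>Skip\<close>, which is why \<open>d\<close> has to
  halt within \<open>u\<close>. The extra transition is the one that discards the finished
  \<open>c\<close>.\<close>

lemma run_Seq:
  assumes "\<And>c' \<sigma>'. (c', \<sigma>') \<in> set_pmf (run t c \<sigma>) \<Longrightarrow> c' = Skip \<and> halts_within u d \<sigma>'"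
  shows "run (Suc (t + u)) (Seq c d) \<sigma> = bind_pmf (run t c \<sigma>) (\<lambda>(c', \<sigma>'). run u d \<sigma>')"
  using assms
proof (induction t arbitrary: c \<sigma>)
  case 0
  then have "c = Skip" by simp
  then show ?case by (simp add: bind_return_pmf)
next
  case (Suc t)
  show ?case
  proof (cases "c = Skip")
    case True
    then have "halts_within u d \<sigma>" using Suc.prems by simp
    then have "run (u + Suc t) d \<sigma> = run u d \<sigma>" by (rule run_halted)
    then have "run (Suc t + u) d \<sigma> = run u d \<sigma>" by (simp only: add.commute)
    then show ?thesis using True by (simp add: bind_return_pmf)
  next
    case False
    have "run (Suc (Suc t + u)) (Seq c d) \<sigma> =
        bind_pmf (step c \<sigma>) (\<lambda>(c', \<sigma>'). run (Suc (t + u)) (Seq c' d) \<sigma>')"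
      using False by (simp only: run.simps(2)[of "Suc t + u"] step.simps if_False bind_map_pmf)
        (simp add: split_def)
    also have "\<dots> = bind_pmf (step c \<sigma>)
        (\<lambda>(c', \<sigma>'). bind_pmf (run t c' \<sigma>') (\<lambda>(c', \<sigma>'). run u d \<sigma>'))"
    proof (intro bind_pmf_cong refl, clarify)
      fix c' \<sigma>' assume "(c', \<sigma>') \<in> set_pmf (step c \<sigma>)"
      then show "run (Suc (t + u)) (Seq c' d) \<sigma>' =
          bind_pmf (run t c' \<sigma>') (\<lambda>(c', \<sigma>'). run u d \<sigma>')"
        by (intro Suc.IH Suc.prems) force
    qed
    finally show ?thesis unfolding run.simps(2)[of t c \<sigma>] bind_assoc_pmf split_def .
  qed
qed

text \<open>The program halts within \<open>t\<close> steps, and its final state follows the distribution \<open>D\<close> up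
  to a coupling that satisfies \<open>R\<close>; so \<open>D\<close> only has to describe the relevant memory cells.\<close>

definition sim :: "nat \<Rightarrow> com \<Rightarrow> state \<Rightarrow> 'a pmf \<Rightarrow> (state \<Rightarrow> 'a \<Rightarrow> bool) \<Rightarrow> bool" where
  "sim t c \<sigma> D R \<longleftrightarrow> rel_pmf (\<lambda>(c', \<sigma>') a. c' = Skip \<and> R \<sigma>' a) (run t c \<sigma>) D"

definition reaches :: "nat \<Rightarrow> com \<Rightarrow> state \<Rightarrow> state \<Rightarrow> bool" where
  "reaches t c \<sigma> \<sigma>' \<longleftrightarrow> run t c \<sigma> = return_pmf (Skip, \<sigma>')"

lemma rel_pmf_imp_set1:
  assumes "rel_pmf R p q" "x \<in> set_pmf p"
  obtains y where "y \<in> set_pmf q" "R x y"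
proof -
  obtain pq where pq: "\<And>x y. (x, y) \<in> set_pmf pq \<Longrightarrow> R x y" "map_pmf fst pq = p" "map_pmf snd pq = q"
    using assms(1) by (auto simp: rel_pmf.simps)
  with assms(2) obtain y where "(x, y) \<in> set_pmf pq" by auto
  with pq that show thesis by (metis image_eqI set_map_pmf snd_conv)
qed

lemma sim_halts: "sim t c \<sigma> D R \<Longrightarrow> halts_within t c \<sigma>"
  unfolding sim_def halts_within_def by (auto elim!: rel_pmf_imp_set1)

lemma sim_mono:
  assumes "sim t c \<sigma> D R" "t \<le> u"
  shows "sim u c \<sigma> D R"
  using assms run_halted[OF sim_halts[OF assms(1)], of "u - t"] by (simp add: sim_def)

lemma sim_weaken:
  assumes "sim t c \<sigma> D R" "\<And>\<sigma>' a. a \<in> set_pmf D \<Longrightarrow> R \<sigma>' a \<Longrightarrow> R' \<sigma>' a"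
  shows "sim t c \<sigma> D R'"
  using assms(1) unfolding sim_def
  by (rule pmf.rel_mono_strong) (use assms(2) in auto)

text \<open>Couplings compose: the runs are coupled through \<open>c\<close> first, then from each
  related pair through \<open>d\<close>. The bound \<open>u\<close> is uniform over the outcomes of
  \<open>c\<close>.\<close>

lemma sim_Seq:
  assumes c: "sim t c \<sigma> D R"
    and d: "\<And>\<sigma>' a. a \<in> set_pmf D \<Longrightarrow> R \<sigma>' a \<Longrightarrow> sim u d \<sigma>' (E a) R'"
  shows "sim (Suc (t + u)) (Seq c d) \<sigma> (bind_pmf D E) R'"
proof -
  have "c' = Skip \<and> halts_within u d \<sigma>'" if z: "(c', \<sigma>') \<in> set_pmf (run t c \<sigma>)" for c' \<sigma>'
  proof -
    obtain a where "a \<in> set_pmf D" "c' = Skip" "R \<sigma>' a"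
      using rel_pmf_imp_set1[OF c[unfolded sim_def] z] by auto
    then show ?thesis using d sim_halts by blast
  qed
  then have run: "run (Suc (t + u)) (Seq c d) \<sigma> =
      bind_pmf (run t c \<sigma>) (\<lambda>(c', \<sigma>'). run u d \<sigma>')"
    by (rule run_Seq)
  have c': "rel_pmf (\<lambda>(c', \<sigma>') a. a \<in> set_pmf D \<and> c' = Skip \<and> R \<sigma>' a) (run t c \<sigma>) D"
    using c unfolding sim_def by (rule pmf.rel_mono_strong) auto
  show ?thesis
    unfolding sim_def run
    by (rule rel_pmf_bindI[OF c']) (use d in \<open>auto simp: sim_def\<close>)
qed

lemma reaches_sim: "reaches t c \<sigma> \<sigma>' \<Longrightarrow> R \<sigma>' a \<Longrightarrow> sim t c \<sigma> (return_pmf a) R"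
  by (simp add: reaches_def sim_def)

section \<open>Single commands and their composition\<close>

lemma reaches_IPut: "reaches 1 (IPut x e f) \<sigma> (iput x (ival e \<sigma>) (ival f \<sigma>) \<sigma>)"
  by (simp add: reaches_def bind_return_pmf)

lemma reaches_RPut: "reaches 1 (RPut x e f) \<sigma> (rput x (ival e \<sigma>) (rval f \<sigma>) \<sigma>)"
  by (simp add: reaches_def bind_return_pmf)

lemma reaches_Skip: "reaches 0 Skip \<sigma> \<sigma>"
  by (simp add: reaches_def)

lemma reaches_Seq:
  assumes "reaches t c \<sigma> \<sigma>'" "reaches u d \<sigma>' \<sigma>''"
  shows "reaches (Suc (t + u)) (Seq c d) \<sigma> \<sigma>''"
proof -
  have "run (Suc (t + u)) (Seq c d) \<sigma> = bind_pmf (run t c \<sigma>) (\<lambda>(c', \<sigma>'). run u d \<sigma>')"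
    by (rule run_Seq) (use assms in \<open>auto simp: reaches_def halts_within_def\<close>)
  with assms show ?thesis by (simp add: reaches_def bind_return_pmf)
qed

lemma reaches_Cond: "reaches t (if bval b \<sigma> then c else d) \<sigma> \<sigma>' \<Longrightarrow> reaches (Suc t) (Cond b c d) \<sigma> \<sigma>'"
  by (simp add: reaches_def bind_return_pmf)

lemma sim_reaches_Seq:
  assumes "reaches t c \<sigma> \<sigma>'" "sim u d \<sigma>' D R"
  shows "sim (Suc (t + u)) (Seq c d) \<sigma> D R"
  using sim_Seq[OF reaches_sim[OF assms(1), of "\<lambda>\<sigma>'' _. \<sigma>'' = \<sigma>'" "()"], of u d "\<lambda>_. D" R] assms(2)
  by (simp add: bind_return_pmf)

text \<open>A deterministic continuation amounts to post-processing the abstract outcome by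
  \<open>h\<close>.\<close>

lemma sim_Seq_reaches:
  assumes "sim t c \<sigma> D R"
    and "\<And>\<sigma>' a. a \<in> set_pmf D \<Longrightarrow> R \<sigma>' a \<Longrightarrow> \<exists>\<sigma>''. reaches u d \<sigma>' \<sigma>'' \<and> R' \<sigma>'' (h a)"
  shows "sim (Suc (t + u)) (Seq c d) \<sigma> (map_pmf h D) R'"
  unfolding map_pmf_def
proof (rule sim_Seq[OF assms(1)])
  fix \<sigma>' a assume "a \<in> set_pmf D" "R \<sigma>' a"
  then obtain \<sigma>'' where "reaches u d \<sigma>' \<sigma>''" "R' \<sigma>'' (h a)" using assms(2) by blast
  then show "sim u d \<sigma>' (return_pmf (h a)) R'" by (rule reaches_sim)
qed

lemma sim_Flip:
  assumes "\<And>b. R (iput x (ival e \<sigma>) (if b then 1 else 0) \<sigma>) (h b)"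
  shows "sim 1 (Flip x e p) \<sigma> (map_pmf h (bernoulli_pmf (rval p \<sigma>))) R"
proof -
  have "run 1 (Flip x e p) \<sigma> =
      map_pmf (\<lambda>b. (Skip, iput x (ival e \<sigma>) (if b then 1 else 0) \<sigma>)) (bernoulli_pmf (rval p \<sigma>))"
    by (simp add: bind_map_pmf map_pmf_def bind_assoc_pmf bind_return_pmf)
  then show ?thesis
    using assms by (simp only: sim_def pmf.rel_map prod.case simp_thms rel_pmf_reflI)
qed

lemma sim_Cond: "sim t (if bval b \<sigma> then c else d) \<sigma> D R \<Longrightarrow> sim (Suc t) (Cond b c d) \<sigma> D R"
  by (simp add: sim_def bind_return_pmf)

section \<open>Iterated random steps and the loop rule\<close>

primrec fiter :: "(nat \<Rightarrow> 'a \<Rightarrow> 'a pmf) \<Rightarrow> nat \<Rightarrow> 'a \<Rightarrow> 'a pmf" where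
  "fiter F 0 a = return_pmf a"
| "fiter F (Suc m) a = bind_pmf (F (Suc m) a) (fiter F m)"

text \<open>The number \<open>m\<close> of remaining rounds is both the loop variant and the index
  of the abstract step. A round costs two transitions beside its body, for the guard and for
  dropping \<open>Skip\<close>; the last guard test costs one.\<close>

lemma sim_While:
  assumes guard: "\<And>m \<sigma> a. I m \<sigma> a \<Longrightarrow> bval b \<sigma> \<longleftrightarrow> m > 0"
    and body: "\<And>m \<sigma> a. I (Suc m) \<sigma> a \<Longrightarrow> sim t c \<sigma> (F (Suc m) a) (I m)"
    and init: "I m \<sigma> a"
  shows "sim (m * (t + 2) + 1) (While b c) \<sigma> (fiter F m a) (I 0)"
  using init
proof (induction m arbitrary: \<sigma> a)
  case 0
  then have "\<not> bval b \<sigma>" using guard by blast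
  with 0 show ?case by (simp add: sim_def bind_return_pmf)
next
  case (Suc m)
  have "sim (Suc (t + (m * (t + 2) + 1))) (Seq c (While b c)) \<sigma> (fiter F (Suc m) a) (I 0)"
    unfolding fiter.simps
    by (rule sim_Seq[OF body[OF Suc.prems]]) (rule Suc.IH)
  moreover have "bval b \<sigma>" using guard[OF Suc.prems] by simp
  moreover have "Suc m * (t + 2) + 1 = Suc (Suc (t + (m * (t + 2) + 1)))" by simp
  ultimately show ?case
    by (simp only: sim_def run.simps(2)[of "Suc _" "While _ _"] step.simps bind_return_pmf if_True prod.case)
qed

lemma sim_out_dist:
  assumes "sim t c \<sigma> D (\<lambda>\<sigma>' d. rmem \<sigma>' ''out'' 0 = d)"
  shows "out_dist t c \<sigma> = D"
proof -
  have "rel_pmf (=) (out_dist t c \<sigma>) D"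
    unfolding out_dist_def pmf.rel_map
    using assms unfolding sim_def by (rule pmf.rel_mono_strong) auto
  then show ?thesis by (simp add: pmf.rel_eq)
qed

section \<open>A hidden Markov model that dominates a signed mixture\<close>

locale components =
  fixes n q k :: nat and \<mu> :: "nat \<Rightarrow> nat \<Rightarrow> nat \<Rightarrow> real"
  assumes n_pos: "n \<ge> 1" and q_pos: "q \<ge> 1" and k_pos: "k \<ge> 1"
    and marginals: "\<And>s i. s \<in> {1..k} \<Longrightarrow> i \<in> {1..n} \<Longrightarrow> distribution_on {1..q} (\<mu> s i)"
begin

lemma marginal_nonneg: "s \<in> {1..k} \<Longrightarrow> i \<in> {1..n} \<Longrightarrow> a \<in> {1..q} \<Longrightarrow> 0 \<le> \<mu> s i a"
  using marginals by (auto simp: distribution_on_def)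

lemma marginal_sum: "s \<in> {1..k} \<Longrightarrow> i \<in> {1..n} \<Longrightarrow> (\<Sum>a=1..q. \<mu> s i a) = 1"
  using marginals by (auto simp: distribution_on_def)

lemma marginal_le_1:
  assumes "s \<in> {1..k}" "i \<in> {1..n}" "a \<in> {1..q}"
  shows "\<mu> s i a \<le> 1"
proof -
  have "\<mu> s i a \<le> (\<Sum>a=1..q. \<mu> s i a)"
    by (rule member_le_sum) (use assms marginal_nonneg in auto)
  with assms show ?thesis by (simp only: marginal_sum)
qed

section \<open>The norm of a signed combination of product functions\<close>

definition combo :: "nat set \<Rightarrow> nat \<Rightarrow> (nat \<Rightarrow> real) \<Rightarrow> (nat \<Rightarrow> nat) \<Rightarrow> real" where
  "combo A m c \<omega> = (\<Sum>s\<in>A. c s * (\<Prod>i=1..m. \<mu> s i (\<omega> i)))"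

text \<open>The l1 norm of \<open>combo A m c\<close> over the cube (\<open>l1_eq_sum_cube\<close>).
  In recursive form, fixing or summing out the last coordinate is a single unfolding that only
  changes the coefficients.\<close>

primrec l1 :: "nat set \<Rightarrow> nat \<Rightarrow> (nat \<Rightarrow> real) \<Rightarrow> real" where
  "l1 A 0 c = \<bar>\<Sum>s\<in>A. c s\<bar>"
| "l1 A (Suc m) c = (\<Sum>a=1..q. l1 A m (\<lambda>s. c s * \<mu> s (Suc m) a))"

lemma l1_cong: "(\<And>s. s \<in> A \<Longrightarrow> c s = d s) \<Longrightarrow> l1 A m c = l1 A m d"
proof (induction m arbitrary: c d)
  case 0 then show ?case by simp
next
  case (Suc m)
  show ?case unfolding l1.simps
    by (intro sum.cong refl Suc.IH) (simp add: Suc.prems)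
qed

lemma l1_nonneg: "0 \<le> l1 A m c"
  by (induction m arbitrary: c) (auto intro: sum_nonneg)

lemma l1_add: "l1 A m (\<lambda>s. c s + d s) \<le> l1 A m c + l1 A m d"
proof (induction m arbitrary: c d)
  case 0
  then show ?case by (simp add: sum.distrib)
next
  case (Suc m)
  have "l1 A (Suc m) (\<lambda>s. c s + d s) \<le>
      (\<Sum>a=1..q. l1 A m (\<lambda>s. c s * \<mu> s (Suc m) a) + l1 A m (\<lambda>s. d s * \<mu> s (Suc m) a))"
    unfolding l1.simps distrib_right by (intro sum_mono Suc.IH)
  then show ?case by (simp add: sum.distrib)
qed

lemma l1_scale: "l1 A m (\<lambda>s. t * c s) = \<bar>t\<bar> * l1 A m c"
proof (induction m arbitrary: c)
  case 0
  then show ?case by (simp flip: sum_distrib_left add: abs_mult)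
next
  case (Suc m)
  then show ?case by (simp add: mult.assoc sum_distrib_left)
qed

lemma l1_sum: "finite J \<Longrightarrow> l1 A m (\<lambda>s. \<Sum>a\<in>J. c a s) \<le> (\<Sum>a\<in>J. l1 A m (c a))"
proof (induction J rule: finite_induct)
  case empty
  have "l1 A m (\<lambda>s. 0 * 0) = 0" unfolding l1_scale by simp
  then show ?case by simp
next
  case (insert a J)
  have "l1 A m (\<lambda>s. c a s + (\<Sum>a\<in>J. c a s)) \<le> l1 A m (c a) + l1 A m (\<lambda>s. \<Sum>a\<in>J. c a s)"
    by (rule l1_add)
  with insert show ?case by simp
qed

lemma l1_insert_zero:
  assumes "finite A" "l \<notin> A" "c l = 0"
  shows "l1 (insert l A) m c = l1 A m c"
  using assms(3) by (induction m arbitrary: c) (simp_all add: assms(1,2))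

lemma l1_slice:
  assumes "a \<in> {1..q}"
  shows "l1 A m (\<lambda>s. c s * \<mu> s (Suc m) a) \<le> l1 A (Suc m) c"
  unfolding l1.simps
  by (rule member_le_sum[where f = "\<lambda>a. l1 A m (\<lambda>s. c s * \<mu> s (Suc m) a)"]) (use assms l1_nonneg in auto)

text \<open>Triangle inequality, since the slices in the last coordinate add up to the
  marginal.\<close>

lemma l1_marginal:
  assumes "A \<subseteq> {1..k}" "Suc m \<le> n"
  shows "l1 A m c \<le> l1 A (Suc m) c"
proof -
  have "l1 A m c = l1 A m (\<lambda>s. \<Sum>a=1..q. c s * \<mu> s (Suc m) a)"
    unfolding sum_distrib_left[symmetric]
    by (rule l1_cong) (use assms in \<open>subst marginal_sum, auto\<close>)
  also have "\<dots> \<le> l1 A (Suc m) c" unfolding l1.simps by (rule l1_sum) simp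
  finally show ?thesis .
qed

text \<open>Subtracting the multiple \<open>\<mu> l (Suc m) a\<close> of a marginal from a slice removes component \<open>l\<close>
  at a bounded cost in norm.\<close>

lemma l1_eliminate:
  assumes A: "finite A" "insert l A \<subseteq> {1..k}" "l \<notin> A" and m: "Suc m \<le> n" and a: "a \<in> {1..q}"
  shows "l1 A m (\<lambda>s. c s * (\<mu> s (Suc m) a - \<mu> l (Suc m) a)) \<le> 2 * l1 (insert l A) (Suc m) c"
proof -
  let ?B = "insert l A"
  have \<mu>: "0 \<le> \<mu> l (Suc m) a" "\<mu> l (Suc m) a \<le> 1"
    using A m a marginal_nonneg marginal_le_1 by auto
  \<comment> \<open>Component \<open>l\<close> has coefficient 0 here, so it can be put back for
    free; the bounds on slice and marginal refer to the full set.\<close>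
  have "l1 A m (\<lambda>s. c s * (\<mu> s (Suc m) a - \<mu> l (Suc m) a)) =
      l1 ?B m (\<lambda>s. c s * (\<mu> s (Suc m) a - \<mu> l (Suc m) a))"
    using A by (subst l1_insert_zero) auto
  also have "\<dots> = l1 ?B m (\<lambda>s. c s * \<mu> s (Suc m) a + (- \<mu> l (Suc m) a) * c s)"
    by (rule l1_cong) (simp add: algebra_simps)
  also have "\<dots> \<le> l1 ?B m (\<lambda>s. c s * \<mu> s (Suc m) a) + \<mu> l (Suc m) a * l1 ?B m c"
    using l1_add[of ?B m "\<lambda>s. c s * \<mu> s (Suc m) a" "\<lambda>s. (- \<mu> l (Suc m) a) * c s"] \<mu>
    unfolding l1_scale by simp
  also have "\<dots> \<le> l1 ?B (Suc m) c + 1 * l1 ?B (Suc m) c"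
    using l1_slice[OF a, of ?B m c] l1_marginal[OF A(2) m, of c] \<mu> l1_nonneg
    by (intro add_mono mult_mono) auto
  finally show ?thesis by simp
qed

section \<open>Domination of the combination by the emission probabilities of the model\<close>

definition \<delta> :: real where "\<delta> = 1 / (2 * real n)"

lemma \<delta>_bounds: "0 < \<delta>" "\<delta> \<le> 1 / 2"
  using n_pos by (auto simp: \<delta>_def field_simps)

text \<open>The reason for the choice of \<open>\<delta>\<close>: with probability at least 1/2 the
  model never jumps, while a single jump costs only a factor \<open>2 * n\<close>.\<close>

lemma stay_power:
  assumes "m \<le> n"
  shows "1 / 2 \<le> (1 - \<delta>) ^ m"
proof -
  have "1 / 2 = 1 + real n * (- \<delta>)" using n_pos by (simp add: \<delta>_def)
  also have "\<dots> \<le> (1 + (- \<delta>)) ^ n"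
    by (rule Bernoulli_inequality) (use \<delta>_bounds in simp)
  also have "\<dots> \<le> (1 - \<delta>) ^ m"
    using assms \<delta>_bounds by (simp add: power_decreasing)
  finally show ?thesis .
qed

text \<open>The probability that the hidden Markov model emits \<open>\<omega> m, \<dots>, \<omega> 1\<close> from component \<open>l\<close>;
  coordinates are processed downwards throughout.\<close>

primrec emit :: "nat \<Rightarrow> nat \<Rightarrow> (nat \<Rightarrow> nat) \<Rightarrow> real" where
  "emit 0 l \<omega> = 1"
| "emit (Suc m) l \<omega> = (1 - \<delta>) * \<mu> l (Suc m) (\<omega> (Suc m)) * emit m l \<omega> +
     \<delta> / (real q * real k) * (\<Sum>s=1..k. emit m s \<omega>)"

lemma emit_nonneg:
  assumes "m \<le> n" "l \<in> {1..k}" "\<And>i. i \<in> {1..m} \<Longrightarrow> \<omega> i \<in> {1..q}"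
  shows "0 \<le> emit m l \<omega>"
  using assms
proof (induction m arbitrary: l)
  case 0 then show ?case by simp
next
  case (Suc m)
  have IH: "0 \<le> emit m s \<omega>" if "s \<in> {1..k}" for s
    using Suc that by auto
  have "0 \<le> \<mu> l (Suc m) (\<omega> (Suc m))"
    using Suc.prems by (intro marginal_nonneg) auto
  with IH Suc.prems(2) \<delta>_bounds show ?case
    unfolding emit.simps
    by (intro add_nonneg_nonneg mult_nonneg_nonneg divide_nonneg_nonneg sum_nonneg) auto
qed

text \<open>\<open>4 * n * q * k\<close> is the factor 2 of \<open>l1_eliminate\<close> times the
  inverse \<open>2 * n * q * k\<close> of the jump coefficient in \<open>emit\<close>; the outer 2
  is the inverse of the bound in \<open>stay_power\<close>.\<close>

primrec ratio_bound :: "nat \<Rightarrow> real" where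
  "ratio_bound 0 = 0"
| "ratio_bound (Suc r) = 2 * (1 + 4 * real n * real q * real k * ratio_bound r)"

lemma ratio_bound_nonneg: "0 \<le> ratio_bound r"
  by (induction r) auto

text \<open>Telescoping along the coordinates for a fixed component \<open>l\<close>; the assumption
  \<open>IH\<close> treats the terms from which \<open>l\<close> has been removed. A fixed
  \<open>K\<close> serves all \<open>m\<close> because summing out coordinates does not increase the
  norm, and each power of \<open>1 - \<delta>\<close> on the left pays for one staying step in
  \<open>emit\<close>.\<close>

lemma combo_le_emit_aux:
  assumes A: "finite A" "insert l A \<subseteq> {1..k}" "l \<notin> A"
    and IH: "\<And>m c. m \<le> n \<Longrightarrow> (\<And>i. i \<in> {1..m} \<Longrightarrow> \<omega> i \<in> {1..q}) \<Longrightarrow>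
      \<bar>combo A m c \<omega>\<bar> \<le> b * l1 A m c * (\<Sum>s=1..k. emit m s \<omega>)"
    and b: "0 \<le> b" and D: "D = 1 + 4 * real n * real q * real k * b"
    and m: "m \<le> n" and \<omega>: "\<And>i. i \<in> {1..m} \<Longrightarrow> \<omega> i \<in> {1..q}"
    and K: "l1 (insert l A) m c \<le> K"
  shows "\<bar>combo (insert l A) m c \<omega>\<bar> * (1 - \<delta>) ^ m \<le> K * D * emit m l \<omega>"
  using m \<omega> K
proof (induction m)
  case 0
  have "1 \<le> D" using b D by simp
  have "0 \<le> K" using 0 l1_nonneg order_trans by metis
  then have "K \<le> K * D" using \<open>1 \<le> D\<close> by (simp add: mult_le_cancel_left1)
  with 0 show ?case by (simp add: combo_def)
next
  case (Suc m)
  let ?B = "insert l A" and ?a = "\<omega> (Suc m)"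
  let ?d = "\<lambda>s. c s * (\<mu> s (Suc m) ?a - \<mu> l (Suc m) ?a)"
  let ?E = "\<Sum>s=1..k. emit m s \<omega>"
  have a: "?a \<in> {1..q}" using Suc.prems by auto
  have \<mu>: "0 \<le> \<mu> l (Suc m) ?a" using A Suc.prems a by (intro marginal_nonneg) auto
  have \<omega>': "\<And>i. i \<in> {1..m} \<Longrightarrow> \<omega> i \<in> {1..q}" using Suc.prems by auto
  have E: "0 \<le> ?E" using Suc.prems \<omega>' by (intro sum_nonneg emit_nonneg) auto
  have "l1 ?B m c \<le> K" using l1_marginal[OF A(2), of m c] Suc.prems by simp
  then have 1: "\<bar>combo ?B m c \<omega>\<bar> * (1 - \<delta>) ^ m \<le> K * D * emit m l \<omega>"
    using Suc by auto
  have "combo A m ?d \<omega> = combo ?B m ?d \<omega>" using A by (simp add: combo_def)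
  then have step: "combo ?B (Suc m) c \<omega> = \<mu> l (Suc m) ?a * combo ?B m c \<omega> + combo A m ?d \<omega>"
    by (simp add: combo_def sum_distrib_left flip: sum.distrib, intro sum.cong arg_cong2[where f = "(+)"])
       (simp_all add: algebra_simps)
  have "\<bar>combo A m ?d \<omega>\<bar> \<le> b * l1 A m ?d * ?E"
    using IH Suc.prems \<omega>' by simp
  also have "\<dots> \<le> b * (2 * K) * ?E"
    using l1_eliminate[OF A Suc.prems(1) a, of c] Suc.prems(3) b E
    by (intro mult_right_mono mult_left_mono) auto
  finally have 2: "\<bar>combo A m ?d \<omega>\<bar> \<le> 2 * b * K * ?E" by simp
  have "\<bar>combo ?B (Suc m) c \<omega>\<bar> * (1 - \<delta>) ^ Suc m \<le>
      (\<mu> l (Suc m) ?a * \<bar>combo ?B m c \<omega>\<bar> + \<bar>combo A m ?d \<omega>\<bar>) * (1 - \<delta>) ^ Suc m"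
    unfolding step using \<mu> \<delta>_bounds abs_triangle_ineq[of "\<mu> l (Suc m) ?a * combo ?B m c \<omega>" "combo A m ?d \<omega>"]
    by (intro mult_right_mono) (simp_all add: abs_mult)
  also have "\<dots> = (1 - \<delta>) * \<mu> l (Suc m) ?a * (\<bar>combo ?B m c \<omega>\<bar> * (1 - \<delta>) ^ m) +
      \<bar>combo A m ?d \<omega>\<bar> * (1 - \<delta>) ^ Suc m"
    by (simp add: algebra_simps)
  \<comment> \<open>The first term matches the branch of \<open>emit\<close> that stays in
    \<open>l\<close>, the second the branch that jumps and so sees the sum \<open>?E\<close> over
    all components.\<close>
  also have "\<dots> \<le> (1 - \<delta>) * \<mu> l (Suc m) ?a * (K * D * emit m l \<omega>) + (2 * b * K * ?E) * 1"
    using \<mu> \<delta>_bounds power_le_one[of "1 - \<delta>" "Suc m"] order_trans[OF abs_ge_zero 2]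
    by (intro add_mono mult_left_mono[OF 1] mult_mono[OF 2]) auto
  also have "2 * b * K * ?E * 1 \<le> K * D * (\<delta> / (real q * real k) * ?E)"
  proof -
    \<comment> \<open>The jump coefficient equals \<open>1 / (2 * n * q * k)\<close>, so the second
      summand of \<open>D\<close> alone yields \<open>2 * b\<close>.\<close>
    have "2 * b \<le> D * (\<delta> / (real q * real k))"
      using n_pos q_pos k_pos b by (simp add: D \<delta>_def field_simps)
    moreover have "0 \<le> K" using Suc.prems(3) l1_nonneg order_trans by metis
    ultimately have "(K * ?E) * (2 * b) \<le> (K * ?E) * (D * (\<delta> / (real q * real k)))"
      using E by (intro mult_left_mono) auto
    then show ?thesis by (simp add: mult_ac)
  qed
  finally show ?case by (simp add: algebra_simps)
qed

text \<open>Induction on the set of components. Bounding the staying probability below by 1/2 and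
  \<open>emit m l\<close> above by the sum over all components makes the right side independent of
  \<open>l\<close>. For \<open>m = n\<close> that sum is \<open>k\<close> times the likelihood of
  the model started in a uniform component.\<close>

lemma combo_le_emit:
  assumes "finite A" "A \<subseteq> {1..k}" "m \<le> n" "\<And>i. i \<in> {1..m} \<Longrightarrow> \<omega> i \<in> {1..q}"
  shows "\<bar>combo A m c \<omega>\<bar> \<le> ratio_bound (card A) * l1 A m c * (\<Sum>s=1..k. emit m s \<omega>)"
  using assms
proof (induction A arbitrary: m c rule: finite_induct)
  case empty
  then show ?case by (simp add: combo_def)
next
  case (insert l A)
  let ?D = "1 + 4 * real n * real q * real k * ratio_bound (card A)"
  have aux: "\<bar>combo (insert l A) m c \<omega>\<bar> * (1 - \<delta>) ^ m \<le> l1 (insert l A) m c * ?D * emit m l \<omega>"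
    using insert by (intro combo_le_emit_aux[where b = "ratio_bound (card A)"] ratio_bound_nonneg) auto
  have "\<bar>combo (insert l A) m c \<omega>\<bar> * (1 / 2) \<le> \<bar>combo (insert l A) m c \<omega>\<bar> * (1 - \<delta>) ^ m"
    using stay_power insert.prems by (intro mult_left_mono) auto
  also note aux
  also have "emit m l \<omega> \<le> (\<Sum>s=1..k. emit m s \<omega>)"
    using insert.prems emit_nonneg by (intro member_le_sum) auto
  finally have "\<bar>combo (insert l A) m c \<omega>\<bar> * (1 / 2) \<le>
      l1 (insert l A) m c * ?D * (\<Sum>s=1..k. emit m s \<omega>)"
    using l1_nonneg ratio_bound_nonneg by (simp add: mult_left_mono)
  moreover have "ratio_bound (card (insert l A)) = 2 * ?D" using insert by simp
  ultimately show ?case by (simp only: mult_ac)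
qed

text \<open>The recursion multiplies by \<open>8 * n * q * k\<close> and adds 2; the base 10 instead
  of 8 leaves room for the addition.\<close>

lemma ratio_bound_le: "ratio_bound (Suc r) \<le> 2 * (10 * real n * real q * real k) ^ r"
proof (induction r)
  case 0 then show ?case by simp
next
  case (Suc r)
  let ?y = "real n * real q * real k"
  have y: "1 \<le> ?y" using n_pos q_pos k_pos
    by (metis One_nat_def Suc_leI mult_pos_pos of_nat_1 of_nat_le_iff of_nat_mult less_eq_Suc_le)
  have "1 \<le> (10 * ?y) ^ r" using y by (intro one_le_power) auto
  then have "1 * 1 \<le> ?y * (10 * ?y) ^ r" using y by (intro mult_mono) auto
  moreover have "8 * ?y * ratio_bound (Suc r) \<le> 8 * ?y * (2 * (10 * ?y) ^ r)"
    using Suc y by (intro mult_left_mono) (simp_all only: mult.assoc)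
  moreover have "ratio_bound (Suc (Suc r)) = 2 + 8 * ?y * ratio_bound (Suc r)"
    unfolding ratio_bound.simps(2)[of "Suc r"] by argo
  moreover have "(10 * ?y) ^ Suc r = 10 * (?y * (10 * ?y) ^ r)" by simp
  ultimately have "ratio_bound (Suc (Suc r)) \<le> 2 * (10 * ?y) ^ Suc r"
    by linarith
  then show ?case by (simp only: mult.assoc)
qed

end

section \<open>Sampling from the hidden Markov model\<close>

lemma expectation_bernoulli_bind:
  fixes h :: "'a \<Rightarrow> real"
  assumes "0 \<le> p" "p \<le> 1" "\<And>b. finite (set_pmf (f b))"
  shows "measure_pmf.expectation (bind_pmf (bernoulli_pmf p) f) h =
    p * measure_pmf.expectation (f True) h + (1 - p) * measure_pmf.expectation (f False) h"
  by (subst pmf_expectation_bind[of UNIV]) (use assms in \<open>auto simp: UNIV_bool\<close>)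

lemma finite_set_fiter:
  assumes "\<And>i a. finite (set_pmf (F i a))"
  shows "finite (set_pmf (fiter F m a))"
  by (induction m arbitrary: a) (auto simp: assms)

section \<open>Reservoir sampling from unnormalised weights with biased coins\<close>

definition reservoir_step :: "nat \<Rightarrow> (nat \<Rightarrow> real) \<Rightarrow> nat \<Rightarrow> nat \<Rightarrow> nat pmf" where
  "reservoir_step q w m x =
     map_pmf (\<lambda>b. if b then m else x) (bernoulli_pmf (w m / (\<Sum>a=m..q. w a)))"

text \<open>One pass from \<open>q\<close> down to 1 needs only the total weight scanned so far. The
  initial 0 is a dummy: for positive weights the first coin has bias 1 and replaces it.\<close>

definition reservoir :: "nat \<Rightarrow> (nat \<Rightarrow> real) \<Rightarrow> nat pmf" where
  "reservoir q w = fiter (reservoir_step q w) q 0"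

lemma finite_reservoir_step: "finite (set_pmf (reservoir_step q w m x))"
  by (simp add: reservoir_step_def)

text \<open>Invariant with \<open>m\<close> symbols still to scan: the current candidate
  \<open>x\<close> stands for the whole weight scanned so far.\<close>

lemma expectation_reservoir_aux:
  fixes h :: "nat \<Rightarrow> real"
  assumes w: "\<And>a. a \<in> {1..q} \<Longrightarrow> 0 < w a" and "m \<le> q"
  shows "(\<Sum>a=1..q. w a) * measure_pmf.expectation (fiter (reservoir_step q w) m x) h =
    (\<Sum>a=1..m. w a * h a) + (\<Sum>a=Suc m..q. w a) * h x"
  using \<open>m \<le> q\<close>
proof (induction m arbitrary: x)
  case 0
  then show ?case by simp
next
  case (Suc m)
  let ?F = "fiter (reservoir_step q w) m"
  let ?T = "\<Sum>a=Suc m..q. w a" and ?W = "\<Sum>a=1..q. w a"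
  have T: "?T = w (Suc m) + (\<Sum>a=Suc (Suc m)..q. w a)"
    using Suc.prems by (simp add: sum.atLeast_Suc_atMost)
  have rest: "0 \<le> (\<Sum>a=Suc (Suc m)..q. w a)"
    by (intro sum_nonneg less_imp_le w) auto
  have wm: "0 < w (Suc m)" using Suc.prems by (intro w) auto
  \<comment> \<open>The coin splits the new scanned weight \<open>?T\<close> into
    \<open>w (Suc m)\<close> for the new symbol and the old scanned weight for
    \<open>x\<close>.\<close>
  define \<rho> where "\<rho> = w (Suc m) / ?T"
  have \<rho>: "0 \<le> \<rho>" "\<rho> \<le> 1" using T rest wm by (auto simp: \<rho>_def)
  have E: "measure_pmf.expectation (fiter (reservoir_step q w) (Suc m) x) h =
      \<rho> * measure_pmf.expectation (?F (Suc m)) h + (1 - \<rho>) * measure_pmf.expectation (?F x) h"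
    unfolding fiter.simps reservoir_step_def[of q w "Suc m"] \<rho>_def[symmetric] bind_map_pmf
    by (subst expectation_bernoulli_bind[OF \<rho>]) (auto intro: finite_set_fiter finite_reservoir_step)
  have "?W * measure_pmf.expectation (fiter (reservoir_step q w) (Suc m) x) h =
      \<rho> * (?W * measure_pmf.expectation (?F (Suc m)) h) +
      (1 - \<rho>) * (?W * measure_pmf.expectation (?F x) h)"
    unfolding E by (simp only: algebra_simps)
  also have "\<dots> = (\<Sum>a=1..m. w a * h a) + (\<rho> * ?T) * h (Suc m) + (?T - \<rho> * ?T) * h x"
    using Suc by (simp add: algebra_simps)
  also have "\<rho> * ?T = w (Suc m)" using T rest wm by (simp add: \<rho>_def)
  finally show ?case using T by simp
qed

lemma pmf_reservoir:
  assumes w: "\<And>a. a \<in> {1..q} \<Longrightarrow> 0 < w a" and q: "q \<ge> 1"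
  shows "pmf (reservoir q w) x = (if x \<in> {1..q} then w x / (\<Sum>a=1..q. w a) else 0)"
proof -
  have "(\<Sum>a=1..q. w a) * pmf (reservoir q w) x =
      (\<Sum>a=1..q. w a) * measure_pmf.expectation (reservoir q w) (indicator {x})"
    by (simp add: pmf.rep_eq)
  also have "\<dots> = (\<Sum>a=1..q. w a * indicator {x} a)"
    unfolding reservoir_def by (subst expectation_reservoir_aux[OF w]) auto
  also have "\<dots> = (\<Sum>a=1..q. if a = x then w x else 0)"
    by (intro sum.cong) (auto simp: indicator_def)
  finally have "(\<Sum>a=1..q. w a) * pmf (reservoir q w) x = (if x \<in> {1..q} then w x else 0)"
    by (simp add: sum.delta)
  moreover have "0 < (\<Sum>a=1..q. w a)" using w q by (intro sum_pos) auto
  ultimately show ?thesis by (auto simp: field_simps)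
qed

lemma set_reservoir:
  assumes "\<And>a. a \<in> {1..q} \<Longrightarrow> 0 < w a" "q \<ge> 1"
  shows "set_pmf (reservoir q w) \<subseteq> {1..q}"
  using pmf_reservoir[OF assms] by (auto simp: set_pmf_iff split: if_splits)

section \<open>Forward vectors and the sampling walk\<close>

context components
begin

text \<open>The forward recursion of the hidden Markov model. Started from the all-ones vector,
  \<open>p s\<close> is \<open>k\<close> times the joint probability of the symbols emitted so far
  and of the current component \<open>s\<close>.\<close>

definition upd :: "nat \<Rightarrow> (nat \<Rightarrow> real) \<Rightarrow> nat \<Rightarrow> nat \<Rightarrow> real" where
  "upd i p a s = p s * ((1 - \<delta>) * \<mu> s i a) + (\<Sum>s=1..k. p s) * (\<delta> / (real q * real k))"

definition symbol_weight :: "nat \<Rightarrow> (nat \<Rightarrow> real) \<Rightarrow> nat \<Rightarrow> real" where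
  "symbol_weight i p a = (\<Sum>s=1..k. upd i p a s)"

definition pos_weights :: "(nat \<Rightarrow> real) \<Rightarrow> bool" where
  "pos_weights p \<longleftrightarrow> (\<forall>s\<in>{1..k}. 0 < p s)"

lemma pos_weights_sum: "pos_weights p \<Longrightarrow> 0 < (\<Sum>s=1..k. p s)"
  using k_pos by (intro sum_pos) (auto simp: pos_weights_def)

text \<open>The jump term keeps every entry positive even where marginals vanish, so all coin biases
  and likelihood ratios have positive denominators.\<close>

lemma pos_weights_upd:
  assumes "pos_weights p" "i \<in> {1..n}" "a \<in> {1..q}"
  shows "pos_weights (upd i p a)"
  unfolding pos_weights_def
proof
  fix s assume s: "s \<in> {1..k}"
  have "0 \<le> p s * ((1 - \<delta>) * \<mu> s i a)"
    using assms s \<delta>_bounds marginal_nonneg[OF s assms(2,3)]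
    by (intro mult_nonneg_nonneg) (auto simp: pos_weights_def less_imp_le)
  moreover have "0 < (\<Sum>s=1..k. p s) * (\<delta> / (real q * real k))"
    using pos_weights_sum[OF assms(1)] \<delta>_bounds q_pos k_pos
    by (intro mult_pos_pos divide_pos_pos) auto
  ultimately show "0 < upd i p a s" unfolding upd_def by linarith
qed

lemma symbol_weight_pos:
  assumes "pos_weights p" "i \<in> {1..n}" "a \<in> {1..q}"
  shows "0 < symbol_weight i p a"
  unfolding symbol_weight_def using pos_weights_sum[OF pos_weights_upd[OF assms]] .

text \<open>Both the staying and the jumping branch emit a probability distribution, so the forward
  mass is conserved and is the normaliser of the next symbol's law.\<close>

lemma sum_symbol_weight:
  assumes "i \<in> {1..n}"
  shows "(\<Sum>a=1..q. symbol_weight i p a) = (\<Sum>s=1..k. p s)"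
proof -
  let ?S = "\<Sum>s=1..k. p s"
  have "(\<Sum>a=1..q. symbol_weight i p a) = (\<Sum>s=1..k. \<Sum>a=1..q. upd i p a s)"
    unfolding symbol_weight_def by (rule sum.swap)
  also have "\<dots> = (\<Sum>s=1..k. p s * (1 - \<delta>) + ?S * \<delta> / real k)"
  proof (intro sum.cong refl)
    fix s assume s: "s \<in> {1..k}"
    have "(\<Sum>a=1..q. upd i p a s) =
        (p s * (1 - \<delta>)) * (\<Sum>a=1..q. \<mu> s i a) + real q * (?S * (\<delta> / (real q * real k)))"
      by (simp add: upd_def sum.distrib sum_distrib_left mult_ac)
    then show "(\<Sum>a=1..q. upd i p a s) = p s * (1 - \<delta>) + ?S * \<delta> / real k"
      using marginal_sum[OF s assms] q_pos by simp
  qed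
  also have "\<dots> = ?S * (1 - \<delta>) + ?S * \<delta>"
    using k_pos by (simp add: sum.distrib sum_distrib_right)
  finally show ?thesis by (simp add: algebra_simps)
qed

text \<open>The pair holds the signed products that build up \<open>combo\<close> and the forward
  vector; the sampled word itself is not stored.\<close>

definition walk_step ::
    "nat \<Rightarrow> (nat \<Rightarrow> real) \<times> (nat \<Rightarrow> real) \<Rightarrow> ((nat \<Rightarrow> real) \<times> (nat \<Rightarrow> real)) pmf" where
  "walk_step i vp = map_pmf (\<lambda>x. (\<lambda>s. fst vp s * \<mu> s i x, upd i (snd vp) x))
     (reservoir q (symbol_weight i (snd vp)))"

text \<open>After \<open>n\<close> steps from the all-ones vector this is
  \<open>\<bar>f\<bar> / (k * R)\<close> at the sampled word, with \<open>R\<close> its likelihood;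
  hence the factors \<open>k\<close> below.\<close>

definition ratio :: "(nat \<Rightarrow> real) \<times> (nat \<Rightarrow> real) \<Rightarrow> real" where
  "ratio vp = \<bar>\<Sum>s=1..k. fst vp s\<bar> / (\<Sum>s=1..k. snd vp s)"

lemma finite_walk: "finite (set_pmf (fiter walk_step m vp))"
  by (intro finite_set_fiter) (auto simp: walk_step_def reservoir_def intro: finite_set_fiter finite_reservoir_step)

text \<open>Unbiasedness of importance sampling, from any intermediate state: the probability of a
  symbol times the current forward mass is the next forward mass, so the normalisers
  telescope.\<close>

lemma expectation_walk:
  assumes "m \<le> n" "pos_weights p"
  shows "(\<Sum>s=1..k. p s) * measure_pmf.expectation (fiter walk_step m (v, p)) ratio = l1 {1..k} m v"
  using assms
proof (induction m arbitrary: v p)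
  case 0
  then show ?case using pos_weights_sum[of p] by (simp add: ratio_def)
next
  case (Suc m)
  have i: "Suc m \<in> {1..n}" using Suc.prems by auto
  let ?w = "symbol_weight (Suc m) p" and ?S = "\<Sum>s=1..k. p s"
  let ?next = "\<lambda>x. (\<lambda>s. v s * \<mu> s (Suc m) x, upd (Suc m) p x)"
  have w: "\<And>a. a \<in> {1..q} \<Longrightarrow> 0 < ?w a" using symbol_weight_pos[OF Suc.prems(2) i] .
  have S: "0 < ?S" using pos_weights_sum Suc.prems by simp
  have E: "measure_pmf.expectation (fiter walk_step (Suc m) (v, p)) ratio =
      (\<Sum>a=1..q. pmf (reservoir q ?w) a * measure_pmf.expectation (fiter walk_step m (?next a)) ratio)"
    unfolding fiter.simps walk_step_def bind_map_pmf fst_conv snd_conv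
    unfolding walk_step_def[symmetric]
    by (subst pmf_expectation_bind[of "{1..q}"]) (use set_reservoir[of q ?w, OF w q_pos] finite_walk in auto)
  have "?S * measure_pmf.expectation (fiter walk_step (Suc m) (v, p)) ratio =
      (\<Sum>a=1..q. ?w a * measure_pmf.expectation (fiter walk_step m (?next a)) ratio)"
    unfolding E sum_distrib_left
  proof (intro sum.cong refl)
    fix a assume "a \<in> {1..q}"
    then have "?S * pmf (reservoir q ?w) a = ?w a"
      using pmf_reservoir[of q ?w, OF w q_pos, where x = a] S
      unfolding sum_symbol_weight[OF i] by simp
    then show "?S * (pmf (reservoir q ?w) a * measure_pmf.expectation (fiter walk_step m (?next a)) ratio)
        = ?w a * measure_pmf.expectation (fiter walk_step m (?next a)) ratio"
      by (simp only: mult.assoc[symmetric])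
  qed
  also have "\<dots> = (\<Sum>a=1..q. l1 {1..k} m (\<lambda>s. v s * \<mu> s (Suc m) a))"
  proof (intro sum.cong refl)
    fix a assume a: "a \<in> {1..q}"
    show "?w a * measure_pmf.expectation (fiter walk_step m (?next a)) ratio =
        l1 {1..k} m (\<lambda>s. v s * \<mu> s (Suc m) a)"
      unfolding symbol_weight_def
      using Suc.prems by (intro Suc.IH pos_weights_upd i a) auto
  qed
  finally show ?case by simp
qed

text \<open>Recovers a word behind each final state. Pairing the forward vector with the backward
  quantities \<open>emit\<close> gives a value that the walk preserves.\<close>

lemma set_walk:
  assumes "m \<le> n" "pos_weights p" "z \<in> set_pmf (fiter walk_step m (v, p))"
  shows "\<exists>y. (\<forall>i\<in>{1..m}. y i \<in> {1..q}) \<and> (\<Sum>s=1..k. fst z s) = combo {1..k} m v y \<and>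
    (\<Sum>s=1..k. snd z s) = (\<Sum>s=1..k. p s * emit m s y)"
  using assms
proof (induction m arbitrary: v p)
  case 0
  then show ?case by (simp add: combo_def)
next
  case (Suc m)
  have i: "Suc m \<in> {1..n}" using Suc.prems by auto
  let ?w = "symbol_weight (Suc m) p" and ?S = "\<Sum>s=1..k. p s"
  have w: "\<And>a. a \<in> {1..q} \<Longrightarrow> 0 < ?w a" using symbol_weight_pos[OF Suc.prems(2) i] .
  from Suc.prems obtain a where a: "a \<in> {1..q}"
    and z: "z \<in> set_pmf (fiter walk_step m (\<lambda>s. v s * \<mu> s (Suc m) a, upd (Suc m) p a))"
    using set_reservoir[of q ?w, OF w q_pos] by (auto simp: walk_step_def[of "Suc m"])
  obtain y where y: "\<And>i. i \<in> {1..m} \<Longrightarrow> y i \<in> {1..q}"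
    and fst: "(\<Sum>s=1..k. fst z s) = combo {1..k} m (\<lambda>s. v s * \<mu> s (Suc m) a) y"
    and snd: "(\<Sum>s=1..k. snd z s) = (\<Sum>s=1..k. upd (Suc m) p a s * emit m s y)"
    using Suc.IH[OF Suc_leD[OF Suc.prems(1)] pos_weights_upd[OF Suc.prems(2) i a] z] by blast
  let ?y = "y(Suc m := a)"
  have emit: "emit j s ?y = emit j s y" if "j \<le> m" for j s
    using that by (induction j arbitrary: s) auto
  have "combo {1..k} (Suc m) v ?y = combo {1..k} m (\<lambda>s. v s * \<mu> s (Suc m) a) y"
    unfolding combo_def
  proof (intro sum.cong refl)
    fix s
    have "(\<Prod>i=1..m. \<mu> s i (?y i)) = (\<Prod>i=1..m. \<mu> s i (y i))"
      by (intro prod.cong) auto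
    then show "v s * (\<Prod>i=1..Suc m. \<mu> s i (?y i)) =
        v s * \<mu> s (Suc m) a * (\<Prod>i=1..m. \<mu> s i (y i))"
      by simp
  qed
  \<comment> \<open>Forward-backward duality: the transition may be applied to either side of the
    pairing.\<close>
  moreover have "(\<Sum>s=1..k. p s * emit (Suc m) s ?y) = (\<Sum>s=1..k. upd (Suc m) p a s * emit m s y)"
  proof -
    let ?c = "\<delta> / (real q * real k)" and ?E = "\<Sum>s=1..k. emit m s y"
    have "(\<Sum>s=1..k. p s * emit (Suc m) s ?y) =
        (\<Sum>s=1..k. p s * ((1 - \<delta>) * \<mu> s (Suc m) a) * emit m s y + p s * (?c * ?E))"
      by (intro sum.cong refl) (simp add: emit algebra_simps)
    also have "\<dots> = (\<Sum>s=1..k. p s * ((1 - \<delta>) * \<mu> s (Suc m) a) * emit m s y) + ?S * ?c * ?E"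
      by (simp only: sum.distrib sum_distrib_right mult.assoc)
    also have "\<dots> = (\<Sum>s=1..k. upd (Suc m) p a s * emit m s y)"
      unfolding sum_distrib_left[of "?S * ?c"] sum.distrib[symmetric] upd_def
      by (simp add: distrib_right)
    finally show ?thesis .
  qed
  moreover have "\<forall>i\<in>{1..Suc m}. ?y i \<in> {1..q}" using y a by (auto simp: le_Suc_eq)
  ultimately show ?case using fst snd by metis
qed

lemma ratio_walk_bounds:
  assumes "z \<in> set_pmf (fiter walk_step n (v, \<lambda>_. 1))"
  shows "0 \<le> ratio z" "ratio z \<le> ratio_bound k * l1 {1..k} n v"
proof -
  have "pos_weights (\<lambda>_. 1)" by (simp add: pos_weights_def)
  from set_walk[OF order_refl this assms] obtain y where y: "\<And>i. i \<in> {1..n} \<Longrightarrow> y i \<in> {1..q}"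
    and fst: "(\<Sum>s=1..k. fst z s) = combo {1..k} n v y"
    and snd: "(\<Sum>s=1..k. snd z s) = (\<Sum>s=1..k. emit n s y)"
    unfolding mult_1 by blast
  have E: "0 \<le> (\<Sum>s=1..k. emit n s y)" using y by (intro sum_nonneg emit_nonneg) auto
  then show "0 \<le> ratio z" unfolding ratio_def snd by simp
  have "\<bar>combo {1..k} n v y\<bar> \<le> ratio_bound k * l1 {1..k} n v * (\<Sum>s=1..k. emit n s y)"
    using combo_le_emit[of "{1..k}" n y v] y by simp
  \<comment> \<open>A zero denominator would give the ratio 0, so nonnegativity of the likelihood is
    enough here.\<close>
  then show "ratio z \<le> ratio_bound k * l1 {1..k} n v"
    unfolding ratio_def fst snd using E ratio_bound_nonneg l1_nonneg
    by (cases "(\<Sum>s=1..k. emit n s y) = 0") (simp_all add: pos_divide_le_eq less_le)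
qed

end

section \<open>The recursive norm as a sum over the cube\<close>

lemma cube_Suc_sum:
  "(\<Sum>y\<in>cube (Suc m) q. F y) = (\<Sum>a=1..q. \<Sum>y\<in>cube m q. F (y(Suc m := a)))"
proof -
  have ins: "{1..Suc m} = insert (Suc m) {1..m}" by auto
  have "(\<Sum>y\<in>cube (Suc m) q. F y) =
      (\<Sum>(a, y)\<in>{1..q} \<times> cube m q. F (y(Suc m := a)))"
    unfolding cube_def ins PiE_insert_eq
    by (subst sum.reindex[OF inj_combinator]) (auto simp: split_def)
  then show ?thesis by (simp add: sum.cartesian_product)
qed

lemma (in components) l1_eq_sum_cube: "l1 A m c = (\<Sum>y\<in>cube m q. \<bar>combo A m c y\<bar>)"
proof (induction m arbitrary: c)
  case 0
  then show ?case by (simp add: cube_def combo_def)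
next
  case (Suc m)
  have "combo A m (\<lambda>s. c s * \<mu> s (Suc m) a) y = combo A (Suc m) c (y(Suc m := a))" for a y
    unfolding combo_def
  proof (intro sum.cong refl)
    fix s
    have "(\<Prod>i=1..m. \<mu> s i ((y(Suc m := a)) i)) = (\<Prod>i=1..m. \<mu> s i (y i))"
      by (intro prod.cong) auto
    then show "c s * \<mu> s (Suc m) a * (\<Prod>i=1..m. \<mu> s i (y i)) =
        c s * (\<Prod>i=1..Suc m. \<mu> s i ((y(Suc m := a)) i))"
      by simp
  qed
  then show ?case unfolding l1.simps Suc cube_Suc_sum by simp
qed

section \<open>Concentration of sums of independent samples\<close>

lemma expectation_square_shift:
  fixes X :: "real pmf"
  assumes "finite (set_pmf X)"
  shows "measure_pmf.expectation X (\<lambda>x. (x + d)\<^sup>2) =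
    measure_pmf.variance X (\<lambda>x. x) + (measure_pmf.expectation X (\<lambda>x. x) + d)\<^sup>2"
proof -
  let ?m = "measure_pmf.expectation X (\<lambda>x. x)"
  have int: "integrable (measure_pmf X) f" for f :: "real \<Rightarrow> real"
    by (rule integrable_measure_pmf_finite[OF assms])
  have "measure_pmf.expectation X (\<lambda>x. (x + d)\<^sup>2) =
      measure_pmf.expectation X (\<lambda>x. (x - ?m)\<^sup>2 + (2 * (?m + d) * x + (d\<^sup>2 - ?m\<^sup>2)))"
    by (rule Bochner_Integration.integral_cong) (auto simp: power2_eq_square algebra_simps)
  also have "\<dots> = measure_pmf.variance X (\<lambda>x. x) + (2 * (?m + d) * ?m + (d\<^sup>2 - ?m\<^sup>2))"
    by (simp only: Bochner_Integration.integral_add[OF int int]) simp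
  finally show ?thesis by (simp add: power2_eq_square algebra_simps)
qed

definition iid_sum :: "real pmf \<Rightarrow> nat \<Rightarrow> real \<Rightarrow> real pmf" where
  "iid_sum X = fiter (\<lambda>_ y. map_pmf (\<lambda>x. y + x) X)"

lemma iid_sum_simps [simp]:
  "iid_sum X 0 y = return_pmf y"
  "iid_sum X (Suc m) y = bind_pmf X (\<lambda>x. iid_sum X m (y + x))"
  by (simp_all add: iid_sum_def bind_map_pmf)

lemma finite_iid_sum: "finite (set_pmf X) \<Longrightarrow> finite (set_pmf (iid_sum X m y))"
  unfolding iid_sum_def by (rule finite_set_fiter) simp

text \<open>Bias-variance decomposition; the free start value \<open>y\<close> lets the induction
  absorb the first sample.\<close>

lemma expectation_iid_sum_square:
  fixes X :: "real pmf"
  assumes fin: "finite (set_pmf X)"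
  shows "measure_pmf.expectation (iid_sum X m y) (\<lambda>z. (z - c)\<^sup>2) =
    real m * measure_pmf.variance X (\<lambda>x. x) + (y + real m * measure_pmf.expectation X (\<lambda>x. x) - c)\<^sup>2"
proof (induction m arbitrary: y)
  case 0
  then show ?case by simp
next
  case (Suc m)
  let ?m = "measure_pmf.expectation X (\<lambda>x. x)" and ?V = "measure_pmf.variance X (\<lambda>x. x)"
  let ?d = "y + real m * ?m - c"
  have int: "integrable (measure_pmf X) f" for f :: "real \<Rightarrow> real"
    by (rule integrable_measure_pmf_finite[OF fin])
  have "measure_pmf.expectation (iid_sum X (Suc m) y) (\<lambda>z. (z - c)\<^sup>2) =
      (\<Sum>x\<in>set_pmf X. pmf X x * (real m * ?V + (y + x + real m * ?m - c)\<^sup>2))"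
    unfolding iid_sum_simps
    by (subst pmf_expectation_bind[OF fin]) (simp_all add: finite_iid_sum fin Suc)
  also have "\<dots> = measure_pmf.expectation X (\<lambda>x. real m * ?V + (x + ?d)\<^sup>2)"
    by (subst integral_measure_pmf[OF fin]) (simp_all add: algebra_simps)
  also have "\<dots> = real m * ?V + (?V + (?m + ?d)\<^sup>2)"
    unfolding expectation_square_shift[OF fin, symmetric]
    by (subst Bochner_Integration.integral_add[OF int int]) simp
  finally show ?case by (simp add: algebra_simps)
qed

lemma set_iid_sum_zero:
  "set_pmf X \<subseteq> {0} \<Longrightarrow> set_pmf (iid_sum X m y) \<subseteq> {y}"
  by (induction m arbitrary: y) fastforce+

text \<open>Since \<open>0 \<le> x \<le> M * \<theta>\<close>, the second moment of a sample is at
  most \<open>M * \<theta>\<^sup>2\<close>. Chebyshev's inequality then bounds the failure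
  probability by \<open>M / (N * \<epsilon>\<^sup>2)\<close>.\<close>

lemma iid_sum_concentration:
  fixes X :: "real pmf" and M \<epsilon> :: real
  defines "\<theta> \<equiv> measure_pmf.expectation X (\<lambda>x. x)"
  assumes fin: "finite (set_pmf X)"
    and X: "\<And>x. x \<in> set_pmf X \<Longrightarrow> 0 \<le> x \<and> x \<le> M * \<theta>"
    and \<epsilon>: "0 < \<epsilon>" and N: "N \<ge> 1" "100 * M \<le> real N * \<epsilon>\<^sup>2"
  shows "measure_pmf.prob (iid_sum X N 0) {y. \<bar>y - real N * \<theta>\<bar> \<le> \<epsilon> * (real N * \<theta>)} \<ge> 99 / 100"
proof -
  have int: "integrable (measure_pmf X) f" for f :: "real \<Rightarrow> real"
    by (rule integrable_measure_pmf_finite[OF fin])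
  have "0 \<le> \<theta>" unfolding \<theta>_def
    by (rule integral_nonneg_AE) (use X in \<open>simp add: AE_measure_pmf_iff\<close>)
  let ?Y = "iid_sum X N 0" and ?a = "\<epsilon> * (real N * \<theta>)"
  show ?thesis
  proof (cases "\<theta> = 0")
    \<comment> \<open>The threshold is 0 here and Chebyshev gives nothing, but all samples
      vanish.\<close>
    case True
    then have "set_pmf X \<subseteq> {0}" using X by fastforce
    then have "set_pmf ?Y \<subseteq> {0}" by (rule set_iid_sum_zero)
    then have "measure_pmf.prob ?Y {y. \<bar>y - real N * \<theta>\<bar> \<le> ?a} = 1"
      using True by (auto simp: measure_pmf.prob_eq_1 AE_measure_pmf_iff)
    then show ?thesis by simp
  next
    case False
    with \<open>0 \<le> \<theta>\<close> have \<theta>: "0 < \<theta>" by simp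
    have a: "0 < ?a" using \<epsilon> N \<theta> by simp
    have "measure_pmf.variance X (\<lambda>x. x) \<le> measure_pmf.expectation X (\<lambda>x. (x + 0)\<^sup>2)"
      unfolding expectation_square_shift[OF fin] by simp
    also have "\<dots> \<le> measure_pmf.expectation X (\<lambda>x. (M * \<theta>) * x)"
      using X by (intro integral_mono_AE int) (auto simp: AE_measure_pmf_iff power2_eq_square mult_right_mono)
    finally have V: "measure_pmf.variance X (\<lambda>x. x) \<le> M * \<theta>\<^sup>2"
      by (simp add: \<theta>_def[symmetric] power2_eq_square mult.assoc)
    have intY: "integrable (measure_pmf ?Y) f" for f :: "real \<Rightarrow> real"
      by (rule integrable_measure_pmf_finite[OF finite_iid_sum[OF fin]])
    have "measure_pmf.prob ?Y {y. ?a\<^sup>2 \<le> (y - real N * \<theta>)\<^sup>2} \<le>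
        measure_pmf.expectation ?Y (\<lambda>y. (y - real N * \<theta>)\<^sup>2) / ?a\<^sup>2"
      using integral_Markov_inequality_measure[of "measure_pmf ?Y" "\<lambda>y. (y - real N * \<theta>)\<^sup>2" "{}" "?a\<^sup>2"] a
        intY \<epsilon> N \<theta> by simp
    also have "\<dots> = real N * measure_pmf.variance X (\<lambda>x. x) / ?a\<^sup>2"
      unfolding expectation_iid_sum_square[OF fin] by (simp add: \<theta>_def)
    also have "\<dots> \<le> real N * (M * \<theta>\<^sup>2) / ?a\<^sup>2"
      using V by (intro divide_right_mono mult_left_mono) auto
    also have "\<dots> = M / (real N * \<epsilon>\<^sup>2)"
      using \<theta> N \<epsilon> by (simp add: power2_eq_square field_simps)
    also have "\<dots> \<le> 1 / 100" using N \<epsilon> by (simp add: pos_divide_le_eq)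
    finally have "measure_pmf.prob ?Y {y. ?a\<^sup>2 \<le> (y - real N * \<theta>)\<^sup>2} \<le> 1 / 100" .
    moreover have "measure_pmf.prob ?Y (- {y. ?a\<^sup>2 \<le> (y - real N * \<theta>)\<^sup>2}) =
        1 - measure_pmf.prob ?Y {y. ?a\<^sup>2 \<le> (y - real N * \<theta>)\<^sup>2}"
      using measure_pmf.prob_compl[of "{y. ?a\<^sup>2 \<le> (y - real N * \<theta>)\<^sup>2}" ?Y] by (simp add: Compl_eq_Diff_UNIV)
    moreover have "measure_pmf.prob ?Y (- {y. ?a\<^sup>2 \<le> (y - real N * \<theta>)\<^sup>2}) \<le>
        measure_pmf.prob ?Y {y. \<bar>y - real N * \<theta>\<bar> \<le> ?a}"
    proof (rule measure_pmf.finite_measure_mono)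
      have "\<bar>y - real N * \<theta>\<bar> \<le> ?a" if "\<not> ?a\<^sup>2 \<le> (y - real N * \<theta>)\<^sup>2" for y
        using that a abs_le_square_iff[of ?a "y - real N * \<theta>"] by linarith
      then show "- {y. ?a\<^sup>2 \<le> (y - real N * \<theta>)\<^sup>2} \<subseteq> {y. \<bar>y - real N * \<theta>\<bar> \<le> ?a}" by blast
    qed simp
    ultimately show ?thesis by linarith
  qed
qed

section \<open>The program\<close>

lemma imem_iput: "imem (iput x j v \<sigma>) y l = (if y = x \<and> l = j then v else imem \<sigma> y l)"
  by (simp add: iput_def)

lemma rmem_iput: "rmem (iput x j v \<sigma>) = rmem \<sigma>"
  by (simp add: iput_def)

lemma imem_rput: "imem (rput x j v \<sigma>) = imem \<sigma>"
  by (simp add: rput_def)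

lemma rmem_rput: "rmem (rput x j v \<sigma>) y l = (if y = x \<and> l = j then v else rmem \<sigma> y l)"
  by (simp add: rput_def)

definition rputs :: "string \<Rightarrow> (nat \<Rightarrow> real) \<Rightarrow> nat \<Rightarrow> state \<Rightarrow> state" where
  "rputs y f k \<sigma> = \<sigma>\<lparr>rmem := (rmem \<sigma>)(y := (\<lambda>j. if j \<in> {1..k} then f j else rmem \<sigma> y j))\<rparr>"

lemma imem_rputs: "imem (rputs y f k \<sigma>) = imem \<sigma>"
  by (simp add: rputs_def)

lemma rmem_rputs: "rmem (rputs y f k \<sigma>) z j = (if z = y \<and> j \<in> {1..k} then f j else rmem \<sigma> z j)"
  by (simp add: rputs_def)

lemmas mem_simps = imem_iput rmem_iput imem_rput rmem_rput imem_rputs rmem_rputs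

lemma input_state_cong:
  assumes "imem \<sigma>' ''n'' = imem \<sigma> ''n''" "imem \<sigma>' ''q'' = imem \<sigma> ''q''"
    and "\<And>x. x \<in> {''eps'', ''alpha'', ''beta'', ''P'', ''Q''} \<Longrightarrow> rmem \<sigma>' x = rmem \<sigma> x"
  shows "input_state k1 k2 n q \<epsilon> \<alpha> P \<beta> Q \<sigma>' = input_state k1 k2 n q \<epsilon> \<alpha> P \<beta> Q \<sigma>"
  using assms by (simp add: input_state_def stores_mixture_def)

lemma input_state_iput:
  "x \<noteq> ''n'' \<Longrightarrow> x \<noteq> ''q'' \<Longrightarrow>
    input_state k1 k2 n q \<epsilon> \<alpha> P \<beta> Q (iput x j v \<sigma>) = input_state k1 k2 n q \<epsilon> \<alpha> P \<beta> Q \<sigma>"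
  by (rule input_state_cong) (simp_all add: iput_def)

lemma input_state_rput:
  "x \<notin> {''eps'', ''alpha'', ''beta'', ''P'', ''Q''} \<Longrightarrow>
    input_state k1 k2 n q \<epsilon> \<alpha> P \<beta> Q (rput x j v \<sigma>) = input_state k1 k2 n q \<epsilon> \<alpha> P \<beta> Q \<sigma>"
  by (rule input_state_cong) (simp_all add: rput_def fun_upd_def, metis)

lemma input_state_rputs:
  "x \<notin> {''eps'', ''alpha'', ''beta'', ''P'', ''Q''} \<Longrightarrow>
    input_state k1 k2 n q \<epsilon> \<alpha> P \<beta> Q (rputs x f k \<sigma>) = input_state k1 k2 n q \<epsilon> \<alpha> P \<beta> Q \<sigma>"
  by (rule input_state_cong) (simp_all add: rputs_def fun_upd_def, metis)

lemmas input_simps = input_state_iput input_state_rput input_state_rputs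

lemma reaches_IPutI:
  "ival e \<sigma> = j \<Longrightarrow> ival f \<sigma> = v \<Longrightarrow> reaches 1 (IPut x e f) \<sigma> (iput x j v \<sigma>)"
  using reaches_IPut by blast

lemma reaches_RPutI:
  "ival e \<sigma> = j \<Longrightarrow> rval f \<sigma> = v \<Longrightarrow> reaches 1 (RPut x e f) \<sigma> (rput x j v \<sigma>)"
  using reaches_RPut by blast

section \<open>Code unrolled over the components, whose number is a constant\<close>

primrec puts :: "string \<Rightarrow> (nat \<Rightarrow> rexp) \<Rightarrow> nat \<Rightarrow> com" where
  "puts y e 0 = Skip"
| "puts y e (Suc k) = Seq (puts y e k) (RPut y (INum (Suc k)) (e (Suc k)))"

text \<open>Expressions are evaluated in the partially updated array, so an in-place update is
  allowed as long as cell \<open>s\<close> is computed from its own old value.\<close>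

lemma reaches_puts:
  assumes "\<And>s. s < k \<Longrightarrow> rval (e (Suc s)) (rputs y f s \<sigma>) = f (Suc s)"
  shows "reaches (2 * k) (puts y e k) \<sigma> (rputs y f k \<sigma>)"
  using assms
proof (induction k)
  case 0
  have "rputs y f 0 \<sigma> = \<sigma>" by (simp add: rputs_def)
  then show ?case using reaches_Skip by simp
next
  case (Suc k)
  have "rput y (Suc k) (f (Suc k)) (rputs y f k \<sigma>) = rputs y f (Suc k) \<sigma>"
    by (auto simp: rput_def rputs_def fun_eq_iff)
  then have "reaches 1 (RPut y (INum (Suc k)) (e (Suc k))) (rputs y f k \<sigma>) (rputs y f (Suc k) \<sigma>)"
    using reaches_RPutI[of "INum (Suc k)" "rputs y f k \<sigma>" "Suc k" "e (Suc k)" "f (Suc k)" y] Suc.prems by simp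
  from reaches_Seq[OF Suc.IH this] Suc.prems show ?case by simp
qed

primrec rsum :: "(nat \<Rightarrow> rexp) \<Rightarrow> nat \<Rightarrow> rexp" where
  "rsum e 0 = ROfNat (INum 0)"
| "rsum e (Suc k) = RAdd (rsum e k) (e (Suc k))"

lemma rval_rsum: "rval (rsum e k) \<sigma> = (\<Sum>s=1..k. rval (e s) \<sigma>)"
  by (induction k) simp_all

primrec ipow :: "iexp \<Rightarrow> nat \<Rightarrow> iexp" where
  "ipow e 0 = INum 1"
| "ipow e (Suc r) = IMul e (ipow e r)"

lemma ival_ipow: "ival (ipow e r) \<sigma> = ival e \<sigma> ^ r"
  by (induction r) simp_all

abbreviation ivar :: "string \<Rightarrow> iexp" where "ivar x \<equiv> IGet x (INum 0)"
abbreviation rvar :: "string \<Rightarrow> rexp" where "rvar x \<equiv> RGet x (INum 0)"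
abbreviation rnum :: "nat \<Rightarrow> rexp" where "rnum m \<equiv> ROfNat (INum m)"

text \<open>The components of both mixtures are numbered consecutively; those of the second one get
  negative coefficients.\<close>

definition joint_marginal ::
    "nat \<Rightarrow> (nat \<Rightarrow> nat \<Rightarrow> nat \<Rightarrow> real) \<Rightarrow> (nat \<Rightarrow> nat \<Rightarrow> nat \<Rightarrow> real) \<Rightarrow> nat \<Rightarrow> nat \<Rightarrow> nat \<Rightarrow> real" where
  "joint_marginal k1 P Q s = (if s \<le> k1 then P s else Q (s - k1))"

definition joint_coeff :: "nat \<Rightarrow> (nat \<Rightarrow> real) \<Rightarrow> (nat \<Rightarrow> real) \<Rightarrow> nat \<Rightarrow> real" where
  "joint_coeff k1 \<alpha> \<beta> s = (if s \<le> k1 then \<alpha> s else - \<beta> (s - k1))"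

definition address_exp :: "nat \<Rightarrow> string \<Rightarrow> iexp" where
  "address_exp s z = IAdd (IMul (IAdd (IMul (INum s) (ivar ''n'')) (ivar ''i'')) (ivar ''q'')) (ivar z)"

definition marginal_exp :: "nat \<Rightarrow> string \<Rightarrow> nat \<Rightarrow> rexp" where
  "marginal_exp k1 z s =
     (if s \<le> k1 then RGet ''P'' (address_exp s z) else RGet ''Q'' (address_exp (s - k1) z))"

definition coeff_exp :: "nat \<Rightarrow> nat \<Rightarrow> rexp" where
  "coeff_exp k1 s =
     (if s \<le> k1 then RGet ''alpha'' (INum s) else RSub (rnum 0) (RGet ''beta'' (INum (s - k1))))"

definition delta_exp :: rexp where
  "delta_exp = RDiv (rnum 1) (RMul (rnum 2) (ROfNat (ivar ''n'')))"

text \<open>The old total is read from \<open>S\<close>, because the cells of \<open>p\<close> are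
  overwritten one by one.\<close>

definition upd_exp :: "nat \<Rightarrow> nat \<Rightarrow> string \<Rightarrow> nat \<Rightarrow> rexp" where
  "upd_exp k1 k z s = RAdd
     (RMul (RGet ''p'' (INum s)) (RMul (RSub (rnum 1) delta_exp) (marginal_exp k1 z s)))
     (RMul (rvar ''S'') (RDiv delta_exp (RMul (ROfNat (ivar ''q'')) (rnum k))))"

definition choose_body :: "nat \<Rightarrow> nat \<Rightarrow> com" where
  "choose_body k1 k =
     Seq (RPut ''T'' (INum 0) (RAdd (rvar ''T'') (rsum (upd_exp k1 k ''a'') k)))
    (Seq (Flip ''b'' (INum 0) (RDiv (rsum (upd_exp k1 k ''a'') k) (rvar ''T'')))
    (Seq (IPut ''x'' (INum 0) (IAdd (IMul (ivar ''b'') (ivar ''a''))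
            (IMul (ISub (INum 1) (ivar ''b'')) (ivar ''x''))))
         (IPut ''a'' (INum 0) (ISub (ivar ''a'') (INum 1)))))"

definition walk_body :: "nat \<Rightarrow> nat \<Rightarrow> com" where
  "walk_body k1 k =
     Seq (RPut ''S'' (INum 0) (rsum (\<lambda>s. RGet ''p'' (INum s)) k))
    (Seq (RPut ''T'' (INum 0) (rnum 0))
    (Seq (IPut ''x'' (INum 0) (INum 0))
    (Seq (IPut ''a'' (INum 0) (ivar ''q''))
    (Seq (While (ILess (INum 0) (ivar ''a'')) (choose_body k1 k))
    (Seq (puts ''v'' (\<lambda>s. RMul (RGet ''v'' (INum s)) (marginal_exp k1 ''x'' s)) k)
    (Seq (puts ''p'' (upd_exp k1 k ''x'') k)
         (IPut ''i'' (INum 0) (ISub (ivar ''i'') (INum 1)))))))))"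

definition sample_body :: "nat \<Rightarrow> nat \<Rightarrow> com" where
  "sample_body k1 k =
     Seq (puts ''v'' (coeff_exp k1) k)
    (Seq (puts ''p'' (\<lambda>_. rnum 1) k)
    (Seq (IPut ''i'' (INum 0) (ivar ''n''))
    (Seq (While (ILess (INum 0) (ivar ''i'')) (walk_body k1 k))
    (Seq (RPut ''f'' (INum 0) (rsum (\<lambda>s. RGet ''v'' (INum s)) k))
    (Seq (Cond (RLess (rvar ''f'') (rnum 0)) (RPut ''f'' (INum 0) (RSub (rnum 0) (rvar ''f'')))
            (RPut ''f'' (INum 0) (rvar ''f'')))
    (Seq (RPut ''acc'' (INum 0)
            (RAdd (rvar ''acc'') (RDiv (rvar ''f'') (rsum (\<lambda>s. RGet ''p'' (INum s)) k))))
         (IPut ''N'' (INum 0) (IAdd (ivar ''N'') (INum 1)))))))))"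

text \<open>Comparing \<open>N * \<epsilon>\<^sup>2\<close> with the target avoids rounding a real
  to obtain the number of samples.\<close>

definition sample_guard :: "nat \<Rightarrow> nat \<Rightarrow> bexp" where
  "sample_guard K k = RLess (RMul (ROfNat (ivar ''N'')) (RMul (rvar ''eps'') (rvar ''eps'')))
     (ROfNat (IMul (INum K) (ipow (IMul (ivar ''n'') (ivar ''q'')) (k - 1))))"

text \<open>A sample has mean \<open>1 / k\<close> times the norm, and total variation is half the
  norm; hence the factor \<open>k / (2 * N)\<close>.\<close>

definition estimator :: "nat \<Rightarrow> nat \<Rightarrow> nat \<Rightarrow> com" where
  "estimator K k1 k =
     Cond (RLess (rvar ''eps'') (rnum 1))
       (Seq (RPut ''acc'' (INum 0) (rnum 0))
       (Seq (IPut ''N'' (INum 0) (INum 0))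
       (Seq (While (sample_guard K k) (sample_body k1 k))
            (RPut ''out'' (INum 0)
               (RDiv (RMul (rnum k) (rvar ''acc'')) (RMul (rnum 2) (ROfNat (ivar ''N''))))))))
       (RPut ''out'' (INum 0) (rnum 0))"

lemma joint_index: "s \<in> {1..k1 + k2} \<Longrightarrow> s \<le> k1 \<or> s - k1 \<in> {1..k2}" for s k1 k2 :: nat
  by auto

section \<open>Each loop of the program simulates its probabilistic counterpart\<close>

locale estimation =
  fixes k1 k2 n q :: nat and \<epsilon> :: real
    and \<alpha> :: "nat \<Rightarrow> real" and P :: "nat \<Rightarrow> nat \<Rightarrow> nat \<Rightarrow> real"
    and \<beta> :: "nat \<Rightarrow> real" and Q :: "nat \<Rightarrow> nat \<Rightarrow> nat \<Rightarrow> real"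
  assumes k1: "k1 \<ge> 1" and k2: "k2 \<ge> 1" and n: "n \<ge> 1" and q: "q \<ge> 1" and \<epsilon>: "\<epsilon> > 0"
    and P: "mixture_data k1 n q \<alpha> P" and Q: "mixture_data k2 n q \<beta> Q"
begin

abbreviation "k \<equiv> k1 + k2"
abbreviation "input \<equiv> input_state k1 k2 n q \<epsilon> \<alpha> P \<beta> Q"
abbreviation "\<mu> \<equiv> joint_marginal k1 P Q"
abbreviation "weight \<equiv> joint_coeff k1 \<alpha> \<beta>"

end

sublocale estimation \<subseteq> components n q "k1 + k2" "joint_marginal k1 P Q"
proof
  show "distribution_on {1..q} (joint_marginal k1 P Q s i)"
    if "s \<in> {1..k1 + k2}" "i \<in> {1..n}" for s i
    using P Q that joint_index[OF that(1)] by (auto simp: mixture_data_def joint_marginal_def)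
qed (use n q k1 in auto)

context estimation
begin

lemma rval_marginal_exp:
  assumes "input \<sigma>" "imem \<sigma> ''i'' 0 = i" "i \<in> {1..n}" "imem \<sigma> z 0 = a" "a \<in> {1..q}" "s \<in> {1..k}"
  shows "rval (marginal_exp k1 z s) \<sigma> = \<mu> s i a"
  using assms joint_index[OF assms(6)]
  by (auto simp: marginal_exp_def address_exp_def joint_marginal_def input_state_def stores_mixture_def)

lemma rval_coeff_exp:
  assumes "input \<sigma>" "s \<in> {1..k}"
  shows "rval (coeff_exp k1 s) \<sigma> = weight s"
  using assms joint_index[OF assms(2)]
  by (auto simp: coeff_exp_def joint_coeff_def input_state_def stores_mixture_def)

lemma rval_upd_exp:
  assumes "input \<sigma>" "imem \<sigma> ''i'' 0 = i" "i \<in> {1..n}" "imem \<sigma> z 0 = a" "a \<in> {1..q}" "s \<in> {1..k}"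
    and "rmem \<sigma> ''p'' s = p s" "rmem \<sigma> ''S'' 0 = (\<Sum>s=1..k. p s)"
  shows "rval (upd_exp k1 k z s) \<sigma> = upd i p a s"
proof -
  have "imem \<sigma> ''n'' 0 = n" "imem \<sigma> ''q'' 0 = q" using assms(1) by (simp_all add: input_state_def)
  then show ?thesis
    using assms(7,8) unfolding upd_exp_def upd_def
    by (simp add: rval_marginal_exp[OF assms(1-6)] delta_exp_def \<delta>_def)
qed

definition sample_inv :: "nat \<Rightarrow> real \<Rightarrow> state \<Rightarrow> bool" where
  "sample_inv N y \<sigma> \<longleftrightarrow> input \<sigma> \<and> imem \<sigma> ''N'' 0 = N \<and> rmem \<sigma> ''acc'' 0 = y"

definition walk_inv ::
    "nat \<Rightarrow> real \<Rightarrow> nat \<Rightarrow> state \<Rightarrow> (nat \<Rightarrow> real) \<times> (nat \<Rightarrow> real) \<Rightarrow> bool" where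
  "walk_inv N y i \<sigma> vp \<longleftrightarrow> sample_inv N y \<sigma> \<and> i \<le> n \<and> imem \<sigma> ''i'' 0 = i \<and> pos_weights (snd vp) \<and>
     (\<forall>s\<in>{1..k}. rmem \<sigma> ''v'' s = fst vp s \<and> rmem \<sigma> ''p'' s = snd vp s)"

definition choose_inv ::
    "nat \<Rightarrow> real \<Rightarrow> nat \<Rightarrow> (nat \<Rightarrow> real) \<times> (nat \<Rightarrow> real) \<Rightarrow> nat \<Rightarrow> state \<Rightarrow> nat \<Rightarrow> bool" where
  "choose_inv N y i vp m \<sigma> x \<longleftrightarrow> walk_inv N y i \<sigma> vp \<and> rmem \<sigma> ''S'' 0 = (\<Sum>s=1..k. snd vp s) \<and>
     m \<le> q \<and> imem \<sigma> ''a'' 0 = m \<and> imem \<sigma> ''x'' 0 = x \<and>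
     rmem \<sigma> ''T'' 0 = (\<Sum>a=Suc m..q. symbol_weight i (snd vp) a)"

lemmas inv_defs = sample_inv_def walk_inv_def choose_inv_def

lemma rval_symbol_weight:
  assumes "choose_inv N y i vp m \<sigma> x" "i \<ge> 1" "imem \<sigma> z 0 = a" "a \<in> {1..q}"
  shows "rval (rsum (upd_exp k1 k z) k) \<sigma> = symbol_weight i (snd vp) a"
  unfolding rval_rsum symbol_weight_def
  by (intro sum.cong refl rval_upd_exp) (use assms in \<open>auto simp: inv_defs\<close>)

lemma sim_choose_body:
  assumes inv: "choose_inv N y i vp (Suc m) \<sigma> x" and i: "i \<ge> 1"
  shows "sim (Suc (1 + Suc (1 + Suc (1 + 1)))) (choose_body k1 k) \<sigma>
    (reservoir_step q (symbol_weight i (snd vp)) (Suc m) x) (choose_inv N y i vp m)"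
  unfolding choose_body_def
proof (rule sim_reaches_Seq)
  let ?w = "symbol_weight i (snd vp)" and ?T = "\<Sum>a=Suc m..q. symbol_weight i (snd vp) a"
  let ?\<sigma>1 = "rput ''T'' 0 ?T \<sigma>"
  have m: "Suc m \<in> {1..q}" "imem \<sigma> ''a'' 0 = Suc m" using inv by (auto simp: choose_inv_def)
  have w: "rval (rsum (upd_exp k1 k ''a'') k) \<sigma> = ?w (Suc m)"
    using rval_symbol_weight[OF inv i m(2,1)] .
  have T: "?T = ?w (Suc m) + (\<Sum>a=Suc (Suc m)..q. ?w a)"
    using m by (simp add: sum.atLeast_Suc_atMost)
  show "reaches 1 (RPut ''T'' (INum 0) (RAdd (rvar ''T'') (rsum (upd_exp k1 k ''a'') k))) \<sigma> ?\<sigma>1"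
    by (rule reaches_RPutI) (use w T inv in \<open>simp_all add: choose_inv_def\<close>)
  \<comment> \<open>The weight is computed again for the coin; writing \<open>T\<close> has not
    changed it.\<close>
  have w1: "rval (rsum (upd_exp k1 k ''a'') k) ?\<sigma>1 = ?w (Suc m)"
    unfolding rval_rsum symbol_weight_def
    by (intro sum.cong refl rval_upd_exp)
      (use inv i m in \<open>auto simp: inv_defs mem_simps input_simps\<close>)
  have p: "rval (RDiv (rsum (upd_exp k1 k ''a'') k) (rvar ''T'')) ?\<sigma>1 = ?w (Suc m) / ?T"
    using w1 by (simp add: mem_simps)
  show "sim (Suc (1 + Suc (1 + 1)))
     (Seq (Flip ''b'' (INum 0) (RDiv (rsum (upd_exp k1 k ''a'') k) (rvar ''T'')))
     (Seq (IPut ''x'' (INum 0) (IAdd (IMul (ivar ''b'') (ivar ''a''))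
             (IMul (ISub (INum 1) (ivar ''b'')) (ivar ''x''))))
          (IPut ''a'' (INum 0) (ISub (ivar ''a'') (INum 1)))))
     ?\<sigma>1 (reservoir_step q ?w (Suc m) x) (choose_inv N y i vp m)"
    unfolding reservoir_step_def p[symmetric]
  proof (rule sim_Seq_reaches)
    show "sim 1 (Flip ''b'' (INum 0) (RDiv (rsum (upd_exp k1 k ''a'') k) (rvar ''T''))) ?\<sigma>1
        (bernoulli_pmf (rval (RDiv (rsum (upd_exp k1 k ''a'') k) (rvar ''T'')) ?\<sigma>1))
        (\<lambda>\<sigma>' b. \<sigma>' = iput ''b'' 0 (if b then 1 else 0) ?\<sigma>1)"
      by (rule sim_Flip[where h = "\<lambda>b. b", unfolded pmf.map_ident]) simp
    fix \<sigma>' b assume \<sigma>': "\<sigma>' = iput ''b'' 0 (if b then 1 else 0) ?\<sigma>1"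
    let ?x = "if b then Suc m else x"
    let ?\<sigma>2 = "iput ''a'' 0 m (iput ''x'' 0 ?x \<sigma>')"
    have "reaches (Suc (1 + 1)) (Seq (IPut ''x'' (INum 0) (IAdd (IMul (ivar ''b'') (ivar ''a''))
             (IMul (ISub (INum 1) (ivar ''b'')) (ivar ''x''))))
          (IPut ''a'' (INum 0) (ISub (ivar ''a'') (INum 1)))) \<sigma>' ?\<sigma>2"
      by (rule reaches_Seq[OF reaches_IPutI reaches_IPutI]) (use inv in \<open>simp_all add: \<sigma>' mem_simps choose_inv_def\<close>)
    moreover have "choose_inv N y i vp m ?\<sigma>2 ?x"
      using inv by (simp add: \<sigma>' inv_defs mem_simps input_simps)
    ultimately show "\<exists>\<sigma>''. reaches (Suc (1 + 1)) (Seq (IPut ''x'' (INum 0) (IAdd (IMul (ivar ''b'') (ivar ''a''))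
             (IMul (ISub (INum 1) (ivar ''b'')) (ivar ''x''))))
          (IPut ''a'' (INum 0) (ISub (ivar ''a'') (INum 1)))) \<sigma>' \<sigma>'' \<and>
        choose_inv N y i vp m \<sigma>'' ?x"
      by blast
  qed
qed

text \<open>Nine transitions per symbol: seven for the body and two for the loop.\<close>

lemma sim_choose:
  assumes inv: "choose_inv N y i vp q \<sigma> 0" and i: "i \<ge> 1"
  shows "sim (q * 9 + 1) (While (ILess (INum 0) (ivar ''a'')) (choose_body k1 k)) \<sigma>
    (reservoir q (symbol_weight i (snd vp))) (choose_inv N y i vp 0)"
proof -
  have "sim (q * (Suc (1 + Suc (1 + Suc (1 + 1))) + 2) + 1)
      (While (ILess (INum 0) (ivar ''a'')) (choose_body k1 k)) \<sigma>
      (fiter (reservoir_step q (symbol_weight i (snd vp))) q 0) (choose_inv N y i vp 0)"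
    by (rule sim_While[where I = "choose_inv N y i vp", OF _ sim_choose_body[OF _ i] inv])
      (auto simp: choose_inv_def)
  then show ?thesis unfolding reservoir_def by (rule sim_mono) simp
qed

lemma sim_walk_body:
  assumes inv: "walk_inv N y (Suc i) \<sigma> vp"
  shows "sim (Suc (1 + Suc (1 + Suc (1 + Suc (1 + Suc ((q * 9 + 1) + Suc (2 * k + Suc (2 * k + 1))))))))
    (walk_body k1 k) \<sigma> (walk_step (Suc i) vp) (walk_inv N y i)"
proof -
  let ?v = "fst vp" and ?p = "snd vp" and ?i = "Suc i"
  let ?\<sigma>1 = "rput ''S'' 0 (\<Sum>s=1..k. ?p s) \<sigma>"
  let ?\<sigma>2 = "rput ''T'' 0 0 ?\<sigma>1"
  let ?\<sigma>3 = "iput ''x'' 0 0 ?\<sigma>2"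
  let ?\<sigma>4 = "iput ''a'' 0 q ?\<sigma>3"
  let ?rest = "Seq (puts ''v'' (\<lambda>s. RMul (RGet ''v'' (INum s)) (marginal_exp k1 ''x'' s)) k)
    (Seq (puts ''p'' (upd_exp k1 k ''x'') k) (IPut ''i'' (INum 0) (ISub (ivar ''i'') (INum 1))))"
  have i: "?i \<in> {1..n}" and pos: "pos_weights ?p" using inv by (auto simp: walk_inv_def)
  have start: "choose_inv N y ?i vp q ?\<sigma>4 0"
    using inv by (simp add: inv_defs mem_simps input_simps)
  have rest: "\<exists>\<sigma>''. reaches (Suc (2 * k + Suc (2 * k + 1))) ?rest \<sigma>' \<sigma>'' \<and>
      walk_inv N y i \<sigma>'' (\<lambda>s. ?v s * \<mu> s ?i x, upd ?i ?p x)"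
    if "x \<in> set_pmf (reservoir q (symbol_weight ?i ?p))" and inv': "choose_inv N y ?i vp 0 \<sigma>' x" for \<sigma>' x
  proof -
    \<comment> \<open>The dummy 0 is outside the support, so the addresses formed from
      \<open>x\<close> point into the input.\<close>
    have x: "x \<in> {1..q}"
      using that set_reservoir[of q "symbol_weight ?i ?p", OF symbol_weight_pos[OF pos i] q] by auto
    let ?\<tau>1 = "rputs ''v'' (\<lambda>s. ?v s * \<mu> s ?i x) k \<sigma>'"
    let ?\<tau>2 = "rputs ''p'' (upd ?i ?p x) k ?\<tau>1"
    let ?\<tau>3 = "iput ''i'' 0 i ?\<tau>2"
    have 1: "reaches (2 * k) (puts ''v'' (\<lambda>s. RMul (RGet ''v'' (INum s)) (marginal_exp k1 ''x'' s)) k) \<sigma>' ?\<tau>1"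
    proof (rule reaches_puts)
      fix s assume s: "s < k"
      let ?\<tau> = "rputs ''v'' (\<lambda>s. ?v s * \<mu> s ?i x) s \<sigma>'"
      have "rval (marginal_exp k1 ''x'' (Suc s)) ?\<tau> = \<mu> (Suc s) ?i x"
        by (rule rval_marginal_exp)
          (use inv' i x s in \<open>simp_all add: inv_defs mem_simps input_simps\<close>)
      then show "rval (RMul (RGet ''v'' (INum (Suc s))) (marginal_exp k1 ''x'' (Suc s))) ?\<tau> =
          ?v (Suc s) * \<mu> (Suc s) ?i x"
        using inv' s by (simp add: inv_defs mem_simps)
    qed
    have 2: "reaches (2 * k) (puts ''p'' (upd_exp k1 k ''x'') k) ?\<tau>1 ?\<tau>2"
      by (rule reaches_puts, rule rval_upd_exp)
        (use inv' i x in \<open>simp_all add: inv_defs mem_simps input_simps\<close>)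
    have 3: "reaches 1 (IPut ''i'' (INum 0) (ISub (ivar ''i'') (INum 1))) ?\<tau>2 ?\<tau>3"
      by (rule reaches_IPutI) (use inv' in \<open>simp_all add: inv_defs mem_simps\<close>)
    have "walk_inv N y i ?\<tau>3 (\<lambda>s. ?v s * \<mu> s ?i x, upd ?i ?p x)"
      using inv' pos_weights_upd[OF pos i x] by (simp add: inv_defs mem_simps input_simps)
    with reaches_Seq[OF 1 reaches_Seq[OF 2 3]] show ?thesis by blast
  qed
  have 1: "reaches 1 (RPut ''S'' (INum 0) (rsum (\<lambda>s. RGet ''p'' (INum s)) k)) \<sigma> ?\<sigma>1"
    by (rule reaches_RPutI) (use inv in \<open>simp_all add: rval_rsum inv_defs\<close>)
  have 2: "reaches 1 (RPut ''T'' (INum 0) (rnum 0)) ?\<sigma>1 ?\<sigma>2"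
    by (rule reaches_RPutI) simp_all
  have 3: "reaches 1 (IPut ''x'' (INum 0) (INum 0)) ?\<sigma>2 ?\<sigma>3"
    by (rule reaches_IPutI) simp_all
  have 4: "reaches 1 (IPut ''a'' (INum 0) (ivar ''q'')) ?\<sigma>3 ?\<sigma>4"
    by (rule reaches_IPutI) (use inv in \<open>simp_all add: inv_defs input_state_def mem_simps\<close>)
  note 5 = sim_Seq_reaches[where u = "Suc (2 * k + Suc (2 * k + 1))" and d = ?rest
      and h = "\<lambda>x. (\<lambda>s. ?v s * \<mu> s ?i x, upd ?i ?p x)" and R' = "walk_inv N y i",
      OF sim_choose[OF start le_add1[of 1 i, unfolded plus_1_eq_Suc]] rest]
  show ?thesis
    unfolding walk_body_def walk_step_def
    by (rule sim_reaches_Seq[OF 1 sim_reaches_Seq[OF 2 sim_reaches_Seq[OF 3 sim_reaches_Seq[OF 4 5]]]])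
qed

text \<open>A coordinate costs \<open>9 * q + 4 * k + 13\<close> transitions in the body and two for
  the loop.\<close>

lemma sim_walk:
  assumes "walk_inv N y n \<sigma> vp"
  shows "sim (n * (9 * q + 4 * k + 15) + 1) (While (ILess (INum 0) (ivar ''i'')) (walk_body k1 k)) \<sigma>
    (fiter walk_step n vp) (walk_inv N y 0)"
  by (rule sim_mono[OF sim_While[where I = "walk_inv N y", OF _ sim_walk_body assms]])
    (auto simp: walk_inv_def algebra_simps)

definition sample_dist :: "real pmf" where
  "sample_dist = map_pmf ratio (fiter walk_step n (weight, \<lambda>_. 1))"

lemma sim_sample_body:
  assumes inv: "sample_inv N y \<sigma>"
  shows "sim (Suc (2 * k + Suc (2 * k + Suc (1 + Suc ((n * (9 * q + 4 * k + 15) + 1) +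
      Suc (1 + Suc (Suc 1 + Suc (1 + 1))))))))
    (sample_body k1 k) \<sigma> (map_pmf (\<lambda>x. y + x) sample_dist) (\<lambda>\<sigma> y. sample_inv (Suc N) y \<sigma>)"
proof -
  let ?\<sigma>1 = "rputs ''v'' weight k \<sigma>"
  let ?\<sigma>2 = "rputs ''p'' (\<lambda>_. 1) k ?\<sigma>1"
  let ?\<sigma>3 = "iput ''i'' 0 n ?\<sigma>2"
  let ?rest = "Seq (RPut ''f'' (INum 0) (rsum (\<lambda>s. RGet ''v'' (INum s)) k))
    (Seq (Cond (RLess (rvar ''f'') (rnum 0)) (RPut ''f'' (INum 0) (RSub (rnum 0) (rvar ''f'')))
       (RPut ''f'' (INum 0) (rvar ''f'')))
    (Seq (RPut ''acc'' (INum 0)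
            (RAdd (rvar ''acc'') (RDiv (rvar ''f'') (rsum (\<lambda>s. RGet ''p'' (INum s)) k))))
         (IPut ''N'' (INum 0) (IAdd (ivar ''N'') (INum 1)))))"
  have start: "walk_inv N y n ?\<sigma>3 (weight, \<lambda>_. 1)"
    using inv by (simp add: inv_defs mem_simps input_simps pos_weights_def)
  have rest: "\<exists>\<sigma>''. reaches (Suc (1 + Suc (Suc 1 + Suc (1 + 1)))) ?rest \<sigma>' \<sigma>'' \<and>
      sample_inv (Suc N) (y + ratio vp) \<sigma>''"
    if inv': "walk_inv N y 0 \<sigma>' vp" for \<sigma>' vp
  proof -
    let ?f = "\<Sum>s=1..k. fst vp s"
    let ?\<tau>1 = "rput ''f'' 0 ?f \<sigma>'"
    let ?\<tau>2 = "rput ''f'' 0 \<bar>?f\<bar> ?\<tau>1"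
    let ?\<tau>3 = "rput ''acc'' 0 (y + ratio vp) ?\<tau>2"
    let ?\<tau>4 = "iput ''N'' 0 (Suc N) ?\<tau>3"
    have "reaches 1 (RPut ''f'' (INum 0) (rsum (\<lambda>s. RGet ''v'' (INum s)) k)) \<sigma>' ?\<tau>1"
      by (rule reaches_RPutI) (use inv' in \<open>simp_all add: rval_rsum inv_defs\<close>)
    moreover have "reaches (Suc 1) (Cond (RLess (rvar ''f'') (rnum 0))
        (RPut ''f'' (INum 0) (RSub (rnum 0) (rvar ''f''))) (RPut ''f'' (INum 0) (rvar ''f''))) ?\<tau>1 ?\<tau>2"
      by (rule reaches_Cond) (auto intro!: reaches_RPutI[unfolded One_nat_def] simp: mem_simps)
    moreover have "reaches 1 (RPut ''acc'' (INum 0)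
            (RAdd (rvar ''acc'') (RDiv (rvar ''f'') (rsum (\<lambda>s. RGet ''p'' (INum s)) k)))) ?\<tau>2 ?\<tau>3"
      by (rule reaches_RPutI) (use inv' in \<open>simp_all add: rval_rsum inv_defs mem_simps ratio_def\<close>)
    moreover have "reaches 1 (IPut ''N'' (INum 0) (IAdd (ivar ''N'') (INum 1))) ?\<tau>3 ?\<tau>4"
      by (rule reaches_IPutI) (use inv' in \<open>simp_all add: inv_defs mem_simps\<close>)
    ultimately have "reaches (Suc (1 + Suc (Suc 1 + Suc (1 + 1)))) ?rest \<sigma>' ?\<tau>4"
      by (intro reaches_Seq)
    moreover have "sample_inv (Suc N) (y + ratio vp) ?\<tau>4"
      using inv' by (simp add: inv_defs mem_simps input_simps)
    ultimately show ?thesis by blast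
  qed
  have 1: "reaches (2 * k) (puts ''v'' (coeff_exp k1) k) \<sigma> ?\<sigma>1"
    by (rule reaches_puts, rule rval_coeff_exp) (use inv in \<open>auto simp: sample_inv_def input_simps\<close>)
  have 2: "reaches (2 * k) (puts ''p'' (\<lambda>_. rnum 1) k) ?\<sigma>1 ?\<sigma>2"
    by (rule reaches_puts) simp
  have 3: "reaches 1 (IPut ''i'' (INum 0) (ivar ''n'')) ?\<sigma>2 ?\<sigma>3"
    by (rule reaches_IPutI) (use inv in \<open>simp_all add: inv_defs input_state_def mem_simps\<close>)
  note 4 = sim_Seq_reaches[where u = "Suc (1 + Suc (Suc 1 + Suc (1 + 1)))" and d = ?rest
      and h = "\<lambda>vp. y + ratio vp" and R' = "\<lambda>\<sigma> y. sample_inv (Suc N) y \<sigma>", OF sim_walk[OF start] rest]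
  show ?thesis
    unfolding sample_body_def sample_dist_def pmf.map_comp o_def
    by (rule sim_reaches_Seq[OF 1 sim_reaches_Seq[OF 2 sim_reaches_Seq[OF 3 4]]])
qed

end

section \<open>Accuracy and running time\<close>

text \<open>Bounds the transitions per sample, including two for the sampling loop.\<close>

definition cost :: "nat \<Rightarrow> nat \<Rightarrow> nat \<Rightarrow> nat" where
  "cost k n q = n * (9 * q + 4 * k + 15) + 4 * k + 16"

context estimation
begin

definition tv :: real where
  "tv = tv_dist (cube n q) (mixture k1 n \<alpha> P) (mixture k2 n \<beta> Q)"

lemma combo_eq_diff: "combo {1..k} n weight y = mixture k1 n \<alpha> P y - mixture k2 n \<beta> Q y"
proof -
  have "combo {1..k} n weight y =
      (\<Sum>s=1..k1. weight s * (\<Prod>i=1..n. \<mu> s i (y i))) +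
      (\<Sum>s=k1+1..k1+k2. weight s * (\<Prod>i=1..n. \<mu> s i (y i)))"
    unfolding combo_def by (rule sum.ub_add_nat) simp
  also have "(\<Sum>s=k1+1..k1+k2. weight s * (\<Prod>i=1..n. \<mu> s i (y i))) = - mixture k2 n \<beta> Q y"
    using sum.shift_bounds_cl_nat_ivl[of "\<lambda>s. weight s * (\<Prod>i=1..n. \<mu> s i (y i))" 1 k1 k2]
    by (simp add: joint_coeff_def joint_marginal_def mixture_def sum_negf add.commute cong: sum.cong_simp)
  also have "(\<Sum>s=1..k1. weight s * (\<Prod>i=1..n. \<mu> s i (y i))) = mixture k1 n \<alpha> P y"
    unfolding mixture_def by (intro sum.cong) (auto simp: joint_coeff_def joint_marginal_def)
  finally show ?thesis by simp
qed

lemma l1_eq_tv: "l1 {1..k} n weight = 2 * tv"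
  unfolding l1_eq_sum_cube combo_eq_diff tv_def tv_dist_def by simp

lemma finite_sample_dist: "finite (set_pmf sample_dist)"
  by (simp add: sample_dist_def finite_walk)

lemma expectation_sample_dist: "real k * measure_pmf.expectation sample_dist (\<lambda>x. x) = 2 * tv"
  using expectation_walk[OF order_refl, of "\<lambda>_. 1" weight, unfolded l1_eq_tv]
  by (simp add: sample_dist_def pos_weights_def)

text \<open>The constant \<open>M\<close> of \<open>iid_sum_concentration\<close>; the factor
  \<open>k\<close> arises since the bound is relative to the mean.\<close>

definition sample_bound :: real where
  "sample_bound = real k * ratio_bound k"

lemma set_sample_dist:
  assumes "x \<in> set_pmf sample_dist"
  shows "0 \<le> x \<and> x \<le> sample_bound * measure_pmf.expectation sample_dist (\<lambda>x. x)"
proof -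
  have "0 \<le> x \<and> x \<le> ratio_bound k * (2 * tv)"
    using assms ratio_walk_bounds[of _ weight, unfolded l1_eq_tv] by (auto simp: sample_dist_def)
  then show ?thesis
    unfolding expectation_sample_dist[symmetric] sample_bound_def by (simp add: mult_ac)
qed

section \<open>The number of samples and the law of the output\<close>

definition runs :: "nat \<Rightarrow> nat" where
  "runs K = nat \<lceil>real K * (real n * real q) ^ (k - 1) / \<epsilon>\<^sup>2\<rceil>"

text \<open>Identifies the ceiling, which occurs only in the analysis, with the point where the loop
  guard first fails.\<close>

lemma less_runs_iff: "N < runs K \<longleftrightarrow> real N * \<epsilon>\<^sup>2 < real K * (real n * real q) ^ (k - 1)"
proof -
  have "N < runs K \<longleftrightarrow> real N < real K * (real n * real q) ^ (k - 1) / \<epsilon>\<^sup>2"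
    unfolding runs_def by (simp add: less_ceiling_iff zless_nat_eq_int_zless)
  then show ?thesis using \<epsilon> by (simp add: pos_less_divide_eq)
qed

lemma sim_sample:
  assumes "sample_inv 0 0 \<sigma>"
  shows "sim (runs K * cost k n q + 1)
    (While (sample_guard K k) (sample_body k1 k)) \<sigma>
    (iid_sum sample_dist (runs K) 0) (\<lambda>\<sigma> y. sample_inv (runs K) y \<sigma>)"
proof -
  have cost_eq: "Suc (2 * k + Suc (2 * k + Suc (1 + Suc ((n * (9 * q + 4 * k + 15) + 1) +
      Suc (1 + Suc (Suc 1 + Suc (1 + 1))))))) + 2 = cost k n q"
    by (simp add: cost_def)
  \<comment> \<open>The loop rule counts remaining rounds down, whereas the program counts samples
    up.\<close>
  define I where "I m \<sigma> y \<longleftrightarrow> m \<le> runs K \<and> sample_inv (runs K - m) y \<sigma>" for m \<sigma> y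
  have *: "sim (Suc (2 * k + Suc (2 * k + Suc (1 + Suc ((n * (9 * q + 4 * k + 15) + 1) +
      Suc (1 + Suc (Suc 1 + Suc (1 + 1)))))))) (sample_body k1 k) \<sigma> (map_pmf (\<lambda>x. y + x) sample_dist) (I m)"
    if "I (Suc m) \<sigma> y" for m \<sigma> y
  proof -
    have inv: "sample_inv (runs K - Suc m) y \<sigma>" and m: "Suc m \<le> runs K"
      using that by (auto simp: I_def)
    from m have "Suc (runs K - Suc m) = runs K - m" by simp
    with sim_sample_body[OF inv] m show ?thesis
      by (auto elim!: sim_weaken simp: I_def)
  qed
  have guard: "bval (sample_guard K k) \<sigma> \<longleftrightarrow> m > 0"
    if "I m \<sigma> y" for m \<sigma> y
  proof -
    have "runs K - m < runs K \<longleftrightarrow> m > 0" using that by (auto simp: I_def)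
    then show ?thesis
      using that less_runs_iff[of "runs K - m" K]
      by (simp add: sample_guard_def I_def sample_inv_def input_state_def ival_ipow power2_eq_square)
  qed
  have init: "I (runs K) \<sigma> 0" using assms by (simp add: I_def)
  from sim_While[where I = I and F = "\<lambda>_ y. map_pmf (\<lambda>x. y + x) sample_dist", OF guard * init]
  have "sim (runs K * cost k n q + 1)
    (While (sample_guard K k) (sample_body k1 k)) \<sigma>
    (iid_sum sample_dist (runs K) 0) (I 0)"
    unfolding iid_sum_def cost_eq .
  then show ?thesis by (rule sim_weaken) (simp add: I_def)
qed

lemma sim_estimator:
  assumes "input \<sigma>" and "\<epsilon> < 1"
  shows "sim (runs K * cost k n q + 8) (estimator K k1 k) \<sigma>
    (map_pmf (\<lambda>y. real k * y / (2 * real (runs K))) (iid_sum sample_dist (runs K) 0))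
    (\<lambda>\<sigma>' d. rmem \<sigma>' ''out'' 0 = d)"
proof -
  let ?\<sigma>1 = "rput ''acc'' 0 0 \<sigma>"
  let ?\<sigma>2 = "iput ''N'' 0 0 ?\<sigma>1"
  have 1: "reaches 1 (RPut ''acc'' (INum 0) (rnum 0)) \<sigma> ?\<sigma>1" by (rule reaches_RPutI) simp_all
  have 2: "reaches 1 (IPut ''N'' (INum 0) (INum 0)) ?\<sigma>1 ?\<sigma>2" by (rule reaches_IPutI) simp_all
  have 3: "sample_inv 0 0 ?\<sigma>2"
    using assms by (simp add: sample_inv_def mem_simps input_simps)
  have 4: "\<exists>\<sigma>''. reaches 1 (RPut ''out'' (INum 0)
        (RDiv (RMul (rnum k) (rvar ''acc'')) (RMul (rnum 2) (ROfNat (ivar ''N''))))) \<sigma>' \<sigma>'' \<and>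
      rmem \<sigma>'' ''out'' 0 = real k * y / (2 * real (runs K))"
    if "sample_inv (runs K) y \<sigma>'" for \<sigma>' y
    by (rule exI[of _ "rput ''out'' 0 (real k * y / (2 * real (runs K))) \<sigma>'"], rule conjI, rule reaches_RPutI)
      (use that in \<open>simp_all add: sample_inv_def mem_simps\<close>)
  note 5 = sim_Seq_reaches[where R' = "\<lambda>\<sigma> d. rmem \<sigma> ''out'' 0 = d" and
      h = "\<lambda>y. real k * y / (2 * real (runs K))", OF sim_sample[OF 3] 4]
  have "bval (RLess (rvar ''eps'') (rnum 1)) \<sigma>"
    using assms by (simp add: input_state_def)
  then have "sim (Suc (Suc (1 + Suc (1 + Suc (runs K * cost k n q + 1 + 1))))) (estimator K k1 k) \<sigma>
    (map_pmf (\<lambda>y. real k * y / (2 * real (runs K))) (iid_sum sample_dist (runs K) 0))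
    (\<lambda>\<sigma>' d. rmem \<sigma>' ''out'' 0 = d)"
    unfolding estimator_def
    by (intro sim_Cond) (simp only: if_True, rule sim_reaches_Seq[OF 1 sim_reaches_Seq[OF 2 5]])
  then show ?thesis by (rule sim_mono) simp
qed

text \<open>Scaling by \<open>k / (2 * N)\<close> sends the mean of the sum to \<open>tv\<close>, so
  the relative error carries over.\<close>

lemma estimator_accurate:
  assumes "runs K \<ge> 1" and "100 * sample_bound \<le> real (runs K) * \<epsilon>\<^sup>2"
  shows "measure_pmf.prob (map_pmf (\<lambda>y. real k * y / (2 * real (runs K))) (iid_sum sample_dist (runs K) 0))
    {d. (1 - \<epsilon>) * tv \<le> d \<and> d \<le> (1 + \<epsilon>) * tv} \<ge> 99 / 100"
proof -
  let ?\<theta> = "measure_pmf.expectation sample_dist (\<lambda>x. x)" and ?N = "real (runs K)"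
  let ?Y = "iid_sum sample_dist (runs K) 0" and ?h = "\<lambda>y. real k * y / (2 * real (runs K))"
  have "99 / 100 \<le> measure_pmf.prob ?Y {y. \<bar>y - ?N * ?\<theta>\<bar> \<le> \<epsilon> * (?N * ?\<theta>)}"
    by (rule iid_sum_concentration[where M = sample_bound])
      (use assms finite_sample_dist set_sample_dist \<epsilon> in auto)
  also have "\<dots> \<le> measure_pmf.prob ?Y (?h -` {d. (1 - \<epsilon>) * tv \<le> d \<and> d \<le> (1 + \<epsilon>) * tv})"
  proof (rule measure_pmf.finite_measure_mono)
    show "{y. \<bar>y - ?N * ?\<theta>\<bar> \<le> \<epsilon> * (?N * ?\<theta>)} \<subseteq>
        ?h -` {d. (1 - \<epsilon>) * tv \<le> d \<and> d \<le> (1 + \<epsilon>) * tv}"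
    proof
      fix y assume "y \<in> {y. \<bar>y - ?N * ?\<theta>\<bar> \<le> \<epsilon> * (?N * ?\<theta>)}"
      then have y: "\<bar>y - ?N * ?\<theta>\<bar> \<le> \<epsilon> * (?N * ?\<theta>)" by simp
      let ?c = "real k / (2 * ?N)"
      have c: "0 \<le> ?c" by simp
      have N: "?N > 0" using assms by simp
      have tv: "?c * (?N * ?\<theta>) = tv" using expectation_sample_dist N by simp
      have "?c * ((1 - \<epsilon>) * (?N * ?\<theta>)) \<le> ?c * y"
        by (rule mult_left_mono[OF _ c]) (use y in \<open>simp add: algebra_simps abs_le_iff\<close>)
      moreover have "?c * y \<le> ?c * ((1 + \<epsilon>) * (?N * ?\<theta>))"
        by (rule mult_left_mono[OF _ c]) (use y in \<open>simp add: algebra_simps abs_le_iff\<close>)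
      moreover have "?c * (z * (?N * ?\<theta>)) = z * tv" for z
        unfolding tv[symmetric] by (simp only: mult_ac)
      ultimately show "y \<in> ?h -` {d. (1 - \<epsilon>) * tv \<le> d \<and> d \<le> (1 + \<epsilon>) * tv}" by simp
    qed
  qed simp
  finally show ?thesis by simp
qed

section \<open>Estimates for the running time\<close>

lemma nq_ge_1: "1 \<le> real n * real q"
  using n q by (metis mult_le_mono of_nat_1 of_nat_le_iff of_nat_mult nat_mult_1)

lemma tv_nonneg: "0 \<le> tv"
  by (simp add: tv_def tv_dist_def sum_nonneg)

text \<open>Both \<open>n\<close> and 1 are at most \<open>n * q\<close>; the coefficients add up as
  \<open>9 + 15 + 16\<close> and \<open>4 * k + 4 * k\<close>.\<close>

lemma cost_le: "real (cost k n q) \<le> (40 + 8 * real k) * (real n * real q)"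
proof -
  have "n \<le> n * q" "1 \<le> n * q" using n q by auto
  then have "4 * k * n \<le> 4 * k * (n * q)" "4 * k \<le> 4 * k * (n * q)"
    using mult_le_mono2[of n "n * q" "4 * k"] mult_le_mono2[of 1 "n * q" "4 * k"] by simp_all
  moreover have "cost k n q = 9 * (n * q) + 4 * k * n + 15 * n + 4 * k + 16"
    by (simp add: cost_def algebra_simps)
  moreover have "(40 + 8 * k) * (n * q) = 40 * (n * q) + 4 * k * (n * q) + 4 * k * (n * q)"
    by (simp add: algebra_simps)
  ultimately have "cost k n q \<le> (40 + 8 * k) * (n * q)"
    using \<open>n \<le> n * q\<close> \<open>1 \<le> n * q\<close> by linarith
  then have "real (cost k n q) \<le> real ((40 + 8 * k) * (n * q))" by (rule of_nat_mono)
  then show ?thesis by simp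
qed

text \<open>Fixes the constant of the guard: 200 is 100 for the failure probability times the 2 of
  \<open>ratio_bound_le\<close>.\<close>

lemma sample_bound_le:
  "100 * sample_bound \<le> real (200 * k * (10 * k) ^ (k - 1)) * (real n * real q) ^ (k - 1)"
proof -
  have "ratio_bound k \<le> 2 * (10 * real n * real q * real k) ^ (k - 1)"
    using ratio_bound_le[of "k - 1"] k1 by simp
  then have "100 * sample_bound \<le> 100 * (real k * (2 * (10 * real n * real q * real k) ^ (k - 1)))"
    unfolding sample_bound_def by (intro mult_left_mono) auto
  also have "(10 * real n * real q * real k) ^ (k - 1) =
      (10 * real k) ^ (k - 1) * (real n * real q) ^ (k - 1)"
    unfolding power_mult_distrib[symmetric] by (simp only: mult_ac)
  finally show ?thesis by (simp add: algebra_simps)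
qed

lemma time_bound:
  assumes "\<epsilon> < 1" "K \<ge> 1"
  shows "real (runs K * cost k n q + 8) \<le>
    (2 * real K * (40 + 8 * real k) + 8) * ((real q)\<^sup>2 * (real n * real q) ^ (2 * (k - 1)) / \<epsilon>\<^sup>2)"
proof -
  let ?y = "real n * real q"
  define B where "B = real K * (real n * real q) ^ (k - 1) / \<epsilon>\<^sup>2"
  let ?G = "(real q)\<^sup>2 * (real n * real q) ^ (2 * (k - 1)) / \<epsilon>\<^sup>2"
  have \<epsilon>2: "0 < \<epsilon>\<^sup>2" "\<epsilon>\<^sup>2 \<le> 1" using assms \<epsilon> by (auto simp: power_le_one)
  have "1 * 1 \<le> real K * ?y ^ (k - 1)"
    using assms nq_ge_1 by (intro mult_mono one_le_power) auto
  then have B: "1 \<le> B" using \<epsilon>2 by (simp add: B_def pos_le_divide_eq)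
  have "real (runs K) \<le> B + 1" unfolding runs_def B_def[symmetric] using B by linarith
  \<comment> \<open>Rounding up costs at most a factor 2 because \<open>B \<ge> 1\<close>.\<close>
  then have "real (runs K) \<le> 2 * B" using B by linarith
  then have "real (runs K) * real (cost k n q) \<le> 2 * B * ((40 + 8 * real k) * ?y)"
    using cost_le by (intro mult_mono) auto
  also have "\<dots> = 2 * real K * (40 + 8 * real k) * (?y ^ (k - 1) * ?y / \<epsilon>\<^sup>2)"
    by (simp add: B_def field_simps)
  also have "?y ^ (k - 1) * ?y / \<epsilon>\<^sup>2 \<le> ?G"
  proof -
    have "?y ^ (k - 1) * ?y = ?y ^ k" using k1 by (simp add: power_eq_if)
    \<comment> \<open>Two mixtures give \<open>k \<ge> 2\<close>, hence
      \<open>k \<le> 2 * (k - 1)\<close>.\<close>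
    also have "\<dots> \<le> ?y ^ (2 * (k - 1))"
      using nq_ge_1 k1 k2 by (intro power_increasing) auto
    also have "\<dots> \<le> (real q)\<^sup>2 * ?y ^ (2 * (k - 1))"
    proof -
      have "1 \<le> (real q)\<^sup>2" using q by (simp add: one_le_power)
      then show ?thesis using nq_ge_1 by (simp add: mult_le_cancel_right1)
    qed
    finally show ?thesis using \<epsilon>2 by (simp add: divide_right_mono)
  qed
  finally have 1: "real (runs K) * real (cost k n q) \<le> 2 * real K * (40 + 8 * real k) * ?G"
    by (simp add: mult_left_mono)
  have "1 * 1 \<le> (real q)\<^sup>2 * ?y ^ (2 * (k - 1))"
    using q nq_ge_1 by (intro mult_mono one_le_power) auto
  then have "1 \<le> ?G" using \<epsilon>2 by (simp add: pos_le_divide_eq)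
  with 1 have "real (runs K) * real (cost k n q) + 8 \<le> 2 * real K * (40 + 8 * real k) * ?G + 8 * ?G"
    by linarith
  then show ?thesis unfolding distrib_right by simp
qed

end

theorem theorem1p1:
  fixes k1 k2 :: nat
  assumes "k1 \<ge> 1" and "k2 \<ge> 1"
  shows "\<exists>(prog :: com) (C :: real). C > 0 \<and>
    (\<forall>(n :: nat) (q :: nat) (\<epsilon> :: real)
        (\<alpha> :: nat \<Rightarrow> real) (P :: nat \<Rightarrow> nat \<Rightarrow> nat \<Rightarrow> real)
        (\<beta> :: nat \<Rightarrow> real) (Q :: nat \<Rightarrow> nat \<Rightarrow> nat \<Rightarrow> real) (\<sigma> :: state).
      n \<ge> 1 \<and> q \<ge> 1 \<and> \<epsilon> > 0 \<and>
      mixture_data k1 n q \<alpha> P \<and> mixture_data k2 n q \<beta> Q \<and>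
      input_state k1 k2 n q \<epsilon> \<alpha> P \<beta> Q \<sigma> \<longrightarrow>
      (\<exists>T :: nat.
        real T \<le> C * max 1 ((real q)\<^sup>2 * (real n * real q) ^ (2 * (k1 + k2 - 1)) / \<epsilon>\<^sup>2) \<and>
        halts_within T prog \<sigma> \<and>
        measure_pmf.prob (out_dist T prog \<sigma>)
          {d. (1 - \<epsilon>) * tv_dist (cube n q) (mixture k1 n \<alpha> P) (mixture k2 n \<beta> Q) \<le> d \<and>
              d \<le> (1 + \<epsilon>) * tv_dist (cube n q) (mixture k1 n \<alpha> P) (mixture k2 n \<beta> Q)}
          \<ge> 99 / 100))"
proof -
  define k where "k = k1 + k2"
  define K where "K = 200 * k * (10 * k) ^ (k - 1)"
  define C where "C = 2 * real K * (40 + 8 * real k) + 8"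
  have K: "K \<ge> 1" using assms by (simp add: K_def k_def)
  have C: "C \<ge> 8" by (simp add: C_def)
  show ?thesis
  proof (intro exI[of _ "estimator K k1 k"] exI[of _ C] conjI allI impI; (elim conjE)?)
    show "C > 0" using C by simp
  next
    fix n q :: nat and \<epsilon> :: real and \<alpha> P \<beta> Q and \<sigma> :: state
    assume hyps: "n \<ge> 1" "q \<ge> 1" "\<epsilon> > 0" "mixture_data k1 n q \<alpha> P" "mixture_data k2 n q \<beta> Q"
      and inp: "input_state k1 k2 n q \<epsilon> \<alpha> P \<beta> Q \<sigma>"
    interpret estimation k1 k2 n q \<epsilon> \<alpha> P \<beta> Q
      by unfold_locales (use assms hyps in auto)
    let ?G = "(real q)\<^sup>2 * (real n * real q) ^ (2 * (k1 + k2 - 1)) / \<epsilon>\<^sup>2"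
    let ?good = "{d. (1 - \<epsilon>) * tv \<le> d \<and> d \<le> (1 + \<epsilon>) * tv}"
    have "\<exists>T :: nat. real T \<le> C * max 1 ?G \<and> halts_within T (estimator K k1 k) \<sigma> \<and>
        measure_pmf.prob (out_dist T (estimator K k1 k) \<sigma>) ?good \<ge> 99 / 100"
    proof (cases "\<epsilon> < 1")
      case True
      note sim = sim_estimator[OF inp True, of K, folded k_def]
      \<comment> \<open>At \<open>N = runs K\<close> the guard fails, which is the required sample
        size.\<close>
      have bound: "100 * sample_bound \<le> real (runs K) * \<epsilon>\<^sup>2"
        using sample_bound_le less_runs_iff[of "runs K" K] by (simp add: K_def k_def)
      \<comment> \<open>At least one sample is drawn, so the final division is not by 0.\<close>
      have "0 < real K * (real n * real q) ^ (k1 + k2 - 1)"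
        using K hyps by (intro mult_pos_pos zero_less_power) auto
      then have "runs K \<ge> 1" using less_runs_iff[of 0 K] by simp
      then have "measure_pmf.prob (out_dist (runs K * cost k n q + 8) (estimator K k1 k) \<sigma>) ?good \<ge> 99 / 100"
        unfolding sim_out_dist[OF sim] using estimator_accurate[OF _ bound] by (simp add: k_def)
      moreover have "real (runs K * cost k n q + 8) \<le> C * ?G"
        using time_bound[OF True K] by (simp add: C_def k_def)
      moreover have "C * ?G \<le> C * max 1 ?G" using C by (intro mult_left_mono) auto
      ultimately show ?thesis using sim_halts[OF sim] order_trans by blast
    next
      case False
      have "sim 2 (estimator K k1 k) \<sigma> (return_pmf 0) (\<lambda>\<sigma>' d. rmem \<sigma>' ''out'' 0 = d)"
      proof -
        have "\<not> bval (RLess (rvar ''eps'') (rnum 1)) \<sigma>" using inp False by (simp add: input_state_def)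
        moreover have "sim 1 (RPut ''out'' (INum 0) (rnum 0)) \<sigma> (return_pmf 0) (\<lambda>\<sigma>' d. rmem \<sigma>' ''out'' 0 = d)"
          by (rule reaches_sim[OF reaches_RPut]) (simp add: mem_simps)
        ultimately show ?thesis
          unfolding estimator_def numeral_2_eq_2 by (intro sim_Cond) simp
      qed
      note sim = this
      have "(1 - \<epsilon>) * tv \<le> 0" using False tv_nonneg by (simp add: mult_nonpos_nonneg)
      moreover have "0 \<le> (1 + \<epsilon>) * tv" using tv_nonneg hyps by simp
      ultimately have "measure_pmf.prob (out_dist 2 (estimator K k1 k) \<sigma>) ?good = 1"
        unfolding sim_out_dist[OF sim] by simp
      \<comment> \<open>For large \<open>\<epsilon>\<close> the quantity \<open>?G\<close> drops
        below 1; the maximum with 1 covers the constant running time.\<close>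
      moreover have "real 2 \<le> C * max 1 ?G"
        using mult_left_mono[of 1 "max 1 ?G" C] C by linarith
      ultimately show ?thesis using sim_halts[OF sim] by (intro exI[of _ 2]) simp
    qed
    then show "\<exists>T :: nat. real T \<le> C * max 1 ?G \<and> halts_within T (estimator K k1 k) \<sigma> \<and>
        measure_pmf.prob (out_dist T (estimator K k1 k) \<sigma>)
          {d. (1 - \<epsilon>) * tv_dist (cube n q) (mixture k1 n \<alpha> P) (mixture k2 n \<beta> Q) \<le> d \<and>
              d \<le> (1 + \<epsilon>) * tv_dist (cube n q) (mixture k1 n \<alpha> P) (mixture k2 n \<beta> Q)} \<ge> 99 / 100"
      unfolding tv_def .
  qed
qed

end
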